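(* Let $\epsilon\in\{-1,1\}$ and let $(M,g,J)$ be a connected and simply-connected non-flat $\epsilon$-Kähler manifold of dimension $2n+4$, $n\geq0$, admitting a strongly degenerate homogeneous $\epsilon$-Kähler structure of linear type. Then $(M,g,J)$ is not geodesically complete.
   Context: Let $\epsilon\in\{-1,1\}$. An $\epsilon$-Kähler manifold $(M,g,J)$ is a pseudo-Riemannian manifold $(M,g)$ of even dimension with a smooth section $J$ of $\mathfrak{so}(TM)$ (i.e. $J$ is $g$-skew-symmetric) such that $J^2=\epsilon\,\mathrm{Id}$ and $\nabla J=0$, $\nabla$ being the Levi-Civita connection. A homogeneous $\epsilon$-Kähler structure is a $(1,2)$-tensor field $S$ such that $\widetilde\nabla=\nabla-S$ satisfies $\widetilde\nabla g=0$, $\widetilde\nabla R=0$, $\widetilde\nabla S=0$, $\widetilde\nabla J=0$, where $R$ is the curvature tensor of $g$. It is of linear type if $$S_XY=g(X,Y)\xi-g(\xi,Y)X+\epsilon g(X,JY)J\xi-\epsilon g(\xi,JY)JX-2g(\zeta,JX)JY$$ for some vector fields $\xi,\zeta$ on $M$; such an $S$ is strongly degenerate if $\xi\neq0$, $g(\xi,\xi)=0$ and $\zeta=0$. *)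

theory Defs
  imports "HOL-Analysis.Analysis"
begin

section \<open>Smooth manifolds\<close>

text \<open>The manifold is the whole type \<open>'m\<close> (Hausdorff and second countable by its type classes),
  modelled on \<open>'e\<close>, so that its dimension is \<open>DIM('e)\<close>. All smoothness notions below are
  meant for open sets.\<close>

abbreviation dder :: "('a::real_normed_vector \<Rightarrow> 'b::real_normed_vector) \<Rightarrow> 'a \<Rightarrow> 'a \<Rightarrow> 'b" where
  "dder f x v \<equiv> frechet_derivative f (at x) v"

primrec C_k_on :: "nat \<Rightarrow> 'a::real_normed_vector set \<Rightarrow> ('a \<Rightarrow> 'b::real_normed_vector) \<Rightarrow> bool" where
  "C_k_on 0 T f \<longleftrightarrow> continuous_on T f"
| "C_k_on (Suc k) T f \<longleftrightarrow>
     (\<forall>x\<in>T. f differentiable (at x)) \<and> (\<forall>v. C_k_on k T (\<lambda>x. dder f x v))"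

definition smooth_on :: "'a::real_normed_vector set \<Rightarrow> ('a \<Rightarrow> 'b::real_normed_vector) \<Rightarrow> bool" where
  "smooth_on T f \<longleftrightarrow> (\<forall>k. C_k_on k T f)"

text \<open>A chart is a pair of its domain and its coordinate map; values of the coordinate map
  outside the domain carry no meaning.\<close>

type_synonym ('m, 'e) chart = "'m set \<times> ('m \<Rightarrow> 'e)"

definition chdom :: "('m, 'e) chart \<Rightarrow> 'm set" where "chdom c = fst c"
definition chmap :: "('m, 'e) chart \<Rightarrow> 'm \<Rightarrow> 'e" where "chmap c = snd c"
definition chinv :: "('m, 'e) chart \<Rightarrow> 'e \<Rightarrow> 'm" where "chinv c = inv_into (chdom c) (chmap c)"
definition chimg :: "('m, 'e) chart \<Rightarrow> 'e set" where "chimg c = chmap c ` chdom c"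

definition is_chart :: "('m::topological_space, 'e::euclidean_space) chart \<Rightarrow> bool" where
  "is_chart c \<longleftrightarrow>
     open (chdom c) \<and> open (chimg c) \<and> homeomorphism (chdom c) (chimg c) (chmap c) (chinv c)"

definition transition :: "('m, 'e) chart \<Rightarrow> ('m, 'e) chart \<Rightarrow> 'e \<Rightarrow> 'e" where
  "transition c d = chmap d \<circ> chinv c"

definition smooth_atlas :: "('m::topological_space, 'e::euclidean_space) chart set \<Rightarrow> bool" where
  "smooth_atlas A \<longleftrightarrow>
     (\<forall>c\<in>A. is_chart c) \<and> (\<Union>c\<in>A. chdom c) = UNIV \<and>
     (\<forall>c\<in>A. \<forall>d\<in>A. smooth_on (chmap c ` (chdom c \<inter> chdom d)) (transition c d))"

section \<open>Tensor fields\<close>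

text \<open>A tensor field on a manifold with atlas \<open>A\<close> is given by its components: \<open>T c x\<close> is its
  expression in the chart \<open>c\<close> at the coordinate point \<open>x \<in> chimg c\<close>, a multilinear
  object on \<open>'e\<close>. The expressions are smooth and change from chart to chart by the
  differential \<open>jac c d p\<close> of the coordinate change from \<open>c\<close> to \<open>d\<close>.\<close>

definition jac :: "('m, 'e::euclidean_space) chart \<Rightarrow> ('m, 'e) chart \<Rightarrow> 'm \<Rightarrow> 'e \<Rightarrow> 'e" where
  "jac c d p u = dder (transition c d) (chmap c p) u"

definition vector_field ::
  "('m, 'e::euclidean_space) chart set \<Rightarrow> (('m, 'e) chart \<Rightarrow> 'e \<Rightarrow> 'e) \<Rightarrow> bool" where
  "vector_field A X \<longleftrightarrow>
     (\<forall>c\<in>A. smooth_on (chimg c) (X c)) \<and>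
     (\<forall>c\<in>A. \<forall>d\<in>A. \<forall>p\<in>chdom c \<inter> chdom d. X d (chmap d p) = jac c d p (X c (chmap c p)))"

definition pseudo_riemannian_metric ::
  "('m, 'e::euclidean_space) chart set \<Rightarrow> (('m, 'e) chart \<Rightarrow> 'e \<Rightarrow> 'e \<Rightarrow> 'e \<Rightarrow> real) \<Rightarrow> bool" where
  "pseudo_riemannian_metric A g \<longleftrightarrow>
     (\<forall>c\<in>A. \<forall>u v. smooth_on (chimg c) (\<lambda>x. g c x u v)) \<and>
     (\<forall>c\<in>A. \<forall>x\<in>chimg c. bilinear (g c x) \<and> (\<forall>u v. g c x u v = g c x v u) \<and>
        (\<forall>u. (\<forall>v. g c x u v = 0) \<longrightarrow> u = 0)) \<and>
     (\<forall>c\<in>A. \<forall>d\<in>A. \<forall>p\<in>chdom c \<inter> chdom d. \<forall>u v.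
        g d (chmap d p) (jac c d p u) (jac c d p v) = g c (chmap c p) u v)"

definition tensor_field_11 ::
  "('m, 'e::euclidean_space) chart set \<Rightarrow> (('m, 'e) chart \<Rightarrow> 'e \<Rightarrow> 'e \<Rightarrow> 'e) \<Rightarrow> bool" where
  "tensor_field_11 A J \<longleftrightarrow>
     (\<forall>c\<in>A. \<forall>u. smooth_on (chimg c) (\<lambda>x. J c x u)) \<and>
     (\<forall>c\<in>A. \<forall>x\<in>chimg c. linear (J c x)) \<and>
     (\<forall>c\<in>A. \<forall>d\<in>A. \<forall>p\<in>chdom c \<inter> chdom d. \<forall>u.
        J d (chmap d p) (jac c d p u) = jac c d p (J c (chmap c p) u))"

definition tensor_field_12 ::
  "('m, 'e::euclidean_space) chart set \<Rightarrow> (('m, 'e) chart \<Rightarrow> 'e \<Rightarrow> 'e \<Rightarrow> 'e \<Rightarrow> 'e) \<Rightarrow> bool" where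
  "tensor_field_12 A S \<longleftrightarrow>
     (\<forall>c\<in>A. \<forall>u v. smooth_on (chimg c) (\<lambda>x. S c x u v)) \<and>
     (\<forall>c\<in>A. \<forall>x\<in>chimg c. bilinear (S c x)) \<and>
     (\<forall>c\<in>A. \<forall>d\<in>A. \<forall>p\<in>chdom c \<inter> chdom d. \<forall>u v.
        S d (chmap d p) (jac c d p u) (jac c d p v) = jac c d p (S c (chmap c p) u v))"

section \<open>Connections\<close>

text \<open>A linear connection is given in each chart by its coefficients \<open>G c x u v\<close>, the covariant
  derivative at \<open>x\<close> of the constant field \<open>v\<close> in the direction \<open>u\<close>. The covariant derivatives
  below, in the direction \<open>w\<close>, of tensor fields of type (0,2), (1,1), (1,2), (1,3) are expressed
  in a single chart, \<open>G\<close> being the coefficients and \<open>h\<close>, \<open>J\<close>, \<open>S\<close>, \<open>R\<close> the components there.\<close>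

definition cov02 ::
  "('e::euclidean_space \<Rightarrow> 'e \<Rightarrow> 'e \<Rightarrow> 'e) \<Rightarrow> ('e \<Rightarrow> 'e \<Rightarrow> 'e \<Rightarrow> real) \<Rightarrow>
    'e \<Rightarrow> 'e \<Rightarrow> 'e \<Rightarrow> 'e \<Rightarrow> real" where
  "cov02 G h x w u v = dder (\<lambda>y. h y u v) x w - h x (G x w u) v - h x u (G x w v)"

definition cov11 ::
  "('e::euclidean_space \<Rightarrow> 'e \<Rightarrow> 'e \<Rightarrow> 'e) \<Rightarrow> ('e \<Rightarrow> 'e \<Rightarrow> 'e) \<Rightarrow> 'e \<Rightarrow> 'e \<Rightarrow> 'e \<Rightarrow> 'e" where
  "cov11 G J x w u = dder (\<lambda>y. J y u) x w + G x w (J x u) - J x (G x w u)"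

definition cov12 ::
  "('e::euclidean_space \<Rightarrow> 'e \<Rightarrow> 'e \<Rightarrow> 'e) \<Rightarrow> ('e \<Rightarrow> 'e \<Rightarrow> 'e \<Rightarrow> 'e) \<Rightarrow>
    'e \<Rightarrow> 'e \<Rightarrow> 'e \<Rightarrow> 'e \<Rightarrow> 'e" where
  "cov12 G S x w u v =
     dder (\<lambda>y. S y u v) x w + G x w (S x u v) - S x (G x w u) v - S x u (G x w v)"

definition cov13 ::
  "('e::euclidean_space \<Rightarrow> 'e \<Rightarrow> 'e \<Rightarrow> 'e) \<Rightarrow> ('e \<Rightarrow> 'e \<Rightarrow> 'e \<Rightarrow> 'e \<Rightarrow> 'e) \<Rightarrow>
    'e \<Rightarrow> 'e \<Rightarrow> 'e \<Rightarrow> 'e \<Rightarrow> 'e \<Rightarrow> 'e" where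
  "cov13 G R x w u v z =
     dder (\<lambda>y. R y u v z) x w + G x w (R x u v z)
     - R x (G x w u) v z - R x u (G x w v) z - R x u v (G x w z)"

text \<open>The coefficients at \<open>x\<close> of the Levi-Civita connection of the local metric \<open>h\<close>: the unique ones
  that are torsion-free (symmetric) and metric. Only the value of \<open>G\<close> at \<open>x\<close> enters
  \<open>cov02 G h x\<close>.\<close>

definition levi_civita_at ::
  "('e::euclidean_space \<Rightarrow> 'e \<Rightarrow> 'e \<Rightarrow> real) \<Rightarrow> 'e \<Rightarrow> ('e \<Rightarrow> 'e \<Rightarrow> 'e) \<Rightarrow> bool" where
  "levi_civita_at h x \<Gamma> \<longleftrightarrow>
     bilinear \<Gamma> \<and> (\<forall>u v. \<Gamma> u v = \<Gamma> v u) \<and> (\<forall>w u v. cov02 (\<lambda>_. \<Gamma>) h x w u v = 0)"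

definition levi_civita ::
  "(('m, 'e::euclidean_space) chart \<Rightarrow> 'e \<Rightarrow> 'e \<Rightarrow> 'e \<Rightarrow> real) \<Rightarrow>
    ('m, 'e) chart \<Rightarrow> 'e \<Rightarrow> 'e \<Rightarrow> 'e \<Rightarrow> 'e" where
  "levi_civita g c x = (THE \<Gamma>. levi_civita_at (g c) x \<Gamma>)"

lemma nondegenerate_representation:
  fixes b :: "'e::euclidean_space \<Rightarrow> 'e \<Rightarrow> real"
  assumes b: "bilinear b" and nd: "\<And>u. (\<forall>v. b u v = 0) \<Longrightarrow> u = 0" and f: "linear f"
  shows "\<exists>!w. \<forall>z. b w z = f z"
proof -
  define L where "L w = (\<Sum>i\<in>Basis. b w i *\<^sub>R i)" for w
  have Li: "L w \<bullet> i = b w i" if "i \<in> Basis" for w i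
    using that by (simp add: L_def inner_sum_left inner_Basis if_distrib cong: if_cong)
  have b1: "linear (b w)" and b2: "linear (\<lambda>w. b w z)" for w z
    using b by (auto simp: bilinear_def)
  have lin: "linear L"
    unfolding L_def
    by (rule linearI) (simp_all add: linear_add[OF b2] linear_scale[OF b2] scaleR_add_left
        sum.distrib scaleR_sum_right)
  have "w = 0" if "L w = 0" for w
  proof -
    have "\<forall>i\<in>Basis. b w i = 0"
      using Li[of _ w] that by simp
    then have "\<forall>v. b w v = 0"
      using linear_eq_stdbasis[OF b1 linear_zero, of w] by metis
    then show ?thesis using nd by blast
  qed
  then have inj: "inj L"
    using lin linear_injective_0 by blast
  have "surj L"
    using linear_injective_imp_surjective[OF lin inj] by simp
  then obtain w where w: "L w = (\<Sum>i\<in>Basis. f i *\<^sub>R i)"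
    by (metis surjD)
  have "b w i = f i" if "i \<in> Basis" for i
    using Li[OF that, of w] that unfolding w
    by (simp add: inner_sum_left inner_Basis if_distrib cong: if_cong)
  then have "b w = f"
    using linear_eq_stdbasis[OF b1 f] by blast
  moreover have "w' = w" if "\<forall>z. b w' z = f z" for w'
  proof -
    have "b (w' - w) v = 0" for v
      using that \<open>b w = f\<close> by (simp add: linear_diff[OF b2])
    then show ?thesis using nd[of "w' - w"] by simp
  qed
  ultimately show ?thesis by (metis (no_types))
qed

text \<open>The fundamental lemma of pseudo-Riemannian geometry: \<open>levi_civita\<close> is well defined.\<close>

lemma levi_civita_at_unique_existence:
  fixes h :: "'e::euclidean_space \<Rightarrow> 'e \<Rightarrow> 'e \<Rightarrow> real"
  assumes T: "open T" "x \<in> T"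
    and df: "\<And>u v. (\<lambda>y. h y u v) differentiable (at x)"
    and bil: "\<And>y. y \<in> T \<Longrightarrow> bilinear (h y)"
    and sym: "\<And>y u v. y \<in> T \<Longrightarrow> h y u v = h y v u"
    and nd: "\<And>u. (\<forall>v. h x u v = 0) \<Longrightarrow> u = 0"
  shows "\<exists>!\<Gamma>. levi_civita_at h x \<Gamma>"
proof -
  define D where "D w u v = dder (\<lambda>y. h y u v) x w" for w u v
  have der: "((\<lambda>y. h y u v) has_derivative (\<lambda>w. D w u v)) (at x)" for u v
    unfolding D_def using df frechet_derivative_works by blast
  have DI: "D w u v = f' w"
    if "(f has_derivative f') (at x)" "\<And>y. y \<in> T \<Longrightarrow> f y = h y u v" for f f' w u v
  proof -
    have "((\<lambda>y. h y u v) has_derivative f') (at x)"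
      using has_derivative_transform_within_open[OF that(1) T that(2)] by simp
    then show ?thesis using der has_derivative_unique by metis
  qed
  have D1: "linear (\<lambda>w. D w u v)" for u v
    using der has_derivative_linear by blast
  have D_sym: "D w u v = D w v u" for w u v
    by (rule DI[OF der]) (use sym in auto)
  have D_add: "D w (u + u') v = D w u v + D w u' v" for w u u' v
    by (rule DI[OF has_derivative_add[OF der der]]) (use bil bilinear_ladd in fastforce)
  have D_scale: "D w (a *\<^sub>R u) v = a * D w u v" for w a u v
    by (rule DI[OF has_derivative_mult_right[OF der]])
      (use bil bilinear_lmul[of "h _"] in fastforce)
  note Dl = linear_add[OF D1] linear_scale[OF D1] D_add D_scale
  have D_add2: "D w v (u + u') = D w v u + D w v u'" for w u u' v
    using D_add D_sym by metis
  have D_scale2: "D w v (a *\<^sub>R u) = a * D w v u" for w a u v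
    using D_scale D_sym by metis
  note Dl = Dl D_add2 D_scale2
  define K where "K u v z = (D u v z + D v u z - D z u v) / 2" for u v z
  have K3: "linear (K u v)" for u v
    by (rule linearI) (simp_all add: K_def Dl algebra_simps add_divide_distrib diff_divide_distrib)
  have hx: "bilinear (h x)" using bil T by blast
  have hl: "linear (\<lambda>w. h x w z)" for z using hx by (auto simp: bilinear_def)
  have ex1: "\<exists>!w. \<forall>z. h x w z = K u v z" for u v
    using nondegenerate_representation[OF hx nd K3] by blast
  define \<Gamma> where "\<Gamma> u v = (THE w. \<forall>z. h x w z = K u v z)" for u v
  have \<Gamma>: "h x (\<Gamma> u v) z = K u v z" for u v z
    using theI'[OF ex1] unfolding \<Gamma>_def by blast
  have \<Gamma>I: "\<Gamma> u v = w" if "\<And>z. h x w z = K u v z" for u v w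
    using ex1[of u v] \<Gamma> that by blast
  have \<Gamma>_sym: "\<Gamma> u v = \<Gamma> v u" for u v
    by (rule \<Gamma>I) (simp add: \<Gamma> K_def D_sym[of _ u v])
  have lin: "linear (\<lambda>u. \<Gamma> u v)" for v
  proof (rule linearI)
    show "\<Gamma> (u + u') v = \<Gamma> u v + \<Gamma> u' v" for u u'
      by (rule \<Gamma>I) (simp add: linear_add[OF hl] \<Gamma> K_def Dl field_simps)
    show "\<Gamma> (a *\<^sub>R u) v = a *\<^sub>R \<Gamma> u v" for a u
      by (rule \<Gamma>I) (simp add: linear_scale[OF hl] \<Gamma> K_def Dl field_simps)
  qed
  moreover have "linear (\<Gamma> v)" for v
    using lin[of v] \<Gamma>_sym[of v] by presburger
  ultimately have "bilinear \<Gamma>" by (auto simp: bilinear_def)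
  moreover have "cov02 (\<lambda>_. \<Gamma>) h x w u v = 0" for w u v
  proof -
    have "h x u (\<Gamma> w v) = K w v u" using sym T \<Gamma> by metis
    then show ?thesis
      by (simp add: cov02_def \<Gamma> D_def[symmetric] K_def D_sym[of v u w] D_sym[of u v w] D_sym[of w v u] field_simps)
  qed
  ultimately have "levi_civita_at h x \<Gamma>"
    using \<Gamma>_sym by (auto simp: levi_civita_at_def)
  moreover have "G = \<Gamma>" if "levi_civita_at h x G" for G
  proof (intro ext)
    fix u v
    have s: "G u v = G v u" for u v
      using that by (auto simp: levi_civita_at_def)
    have m: "D w u v = h x (G w u) v + h x (G w v) u" for w u v
    proof -
      have "cov02 (\<lambda>_. G) h x w u v = 0"
        using that by (auto simp: levi_civita_at_def)
      then show ?thesis using sym[OF T(2), of u] by (simp add: cov02_def D_def)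
    qed
    have "\<Gamma> u v = G u v"
    proof (rule \<Gamma>I)
      fix z
      show "h x (G u v) z = K u v z"
        unfolding K_def m s[of v u] s[of z u] s[of z v] by simp
    qed
    then show "G u v = \<Gamma> u v" by simp
  qed
  ultimately show ?thesis by blast
qed

text \<open>\<open>curvature g c x u v z\<close> is \<open>R(u,v)z\<close>, with \<open>R(X,Y) = [\<nabla>X, \<nabla>Y] - \<nabla>[X,Y]\<close>.\<close>

definition curvature ::
  "(('m, 'e::euclidean_space) chart \<Rightarrow> 'e \<Rightarrow> 'e \<Rightarrow> 'e \<Rightarrow> real) \<Rightarrow>
    ('m, 'e) chart \<Rightarrow> 'e \<Rightarrow> 'e \<Rightarrow> 'e \<Rightarrow> 'e \<Rightarrow> 'e" where
  "curvature g c x u v z =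
     (let \<Gamma> = levi_civita g c in
       dder (\<lambda>y. \<Gamma> y v z) x u - dder (\<lambda>y. \<Gamma> y u z) x v + \<Gamma> x u (\<Gamma> x v z) - \<Gamma> x v (\<Gamma> x u z))"

definition flat ::
  "('m, 'e::euclidean_space) chart set \<Rightarrow> (('m, 'e) chart \<Rightarrow> 'e \<Rightarrow> 'e \<Rightarrow> 'e \<Rightarrow> real) \<Rightarrow> bool" where
  "flat A g \<longleftrightarrow> (\<forall>c\<in>A. \<forall>x\<in>chimg c. \<forall>u v z. curvature g c x u v z = 0)"

section \<open>Geodesics\<close>

text \<open>The local velocity \<open>v\<close> is defined near \<open>t\<close> because \<open>I\<close> is open and \<open>\<gamma>\<close> continuous.
  Solutions of the geodesic equation are automatically smooth.\<close>

definition geodesic_on ::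
  "('m::topological_space, 'e::euclidean_space) chart set \<Rightarrow>
    (('m, 'e) chart \<Rightarrow> 'e \<Rightarrow> 'e \<Rightarrow> 'e \<Rightarrow> real) \<Rightarrow> real set \<Rightarrow> (real \<Rightarrow> 'm) \<Rightarrow> bool" where
  "geodesic_on A g I \<gamma> \<longleftrightarrow>
     open I \<and> is_interval I \<and> I \<noteq> {} \<and> continuous_on I \<gamma> \<and>
     (\<forall>c\<in>A. \<forall>t\<in>I. \<gamma> t \<in> chdom c \<longrightarrow>
       (\<exists>v. (\<forall>\<^sub>F s in nhds t. ((\<lambda>r. chmap c (\<gamma> r)) has_vector_derivative v s) (at s)) \<and>
            (v has_vector_derivative - levi_civita g c (chmap c (\<gamma> t)) (v t) (v t)) (at t)))"

definition geodesically_complete ::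
  "('m::topological_space, 'e::euclidean_space) chart set \<Rightarrow>
    (('m, 'e) chart \<Rightarrow> 'e \<Rightarrow> 'e \<Rightarrow> 'e \<Rightarrow> real) \<Rightarrow> bool" where
  "geodesically_complete A g \<longleftrightarrow>
     (\<forall>I \<gamma>. geodesic_on A g I \<gamma> \<longrightarrow> (\<exists>\<gamma>'. geodesic_on A g UNIV \<gamma>' \<and> (\<forall>t\<in>I. \<gamma>' t = \<gamma> t)))"

section \<open>Homogeneous epsilon-Kaehler structures of linear type\<close>

definition eps_kaehler_manifold ::
  "real \<Rightarrow> ('m::{t2_space,second_countable_topology}, 'e::euclidean_space) chart set \<Rightarrow>
    (('m, 'e) chart \<Rightarrow> 'e \<Rightarrow> 'e \<Rightarrow> 'e \<Rightarrow> real) \<Rightarrow> (('m, 'e) chart \<Rightarrow> 'e \<Rightarrow> 'e \<Rightarrow> 'e) \<Rightarrow> bool" where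
  "eps_kaehler_manifold \<epsilon> A g J \<longleftrightarrow>
     smooth_atlas A \<and> even (DIM('e)) \<and> pseudo_riemannian_metric A g \<and> tensor_field_11 A J \<and>
     (\<forall>c\<in>A. \<forall>x\<in>chimg c.
        (\<forall>u v. g c x (J c x u) v = - g c x u (J c x v)) \<and>
        (\<forall>u. J c x (J c x u) = \<epsilon> *\<^sub>R u) \<and>
        (\<forall>w u. cov11 (levi_civita g c) (J c) x w u = 0))"

definition homogeneous_eps_kaehler_structure ::
  "('m, 'e::euclidean_space) chart set \<Rightarrow> (('m, 'e) chart \<Rightarrow> 'e \<Rightarrow> 'e \<Rightarrow> 'e \<Rightarrow> real) \<Rightarrow>
    (('m, 'e) chart \<Rightarrow> 'e \<Rightarrow> 'e \<Rightarrow> 'e) \<Rightarrow> (('m, 'e) chart \<Rightarrow> 'e \<Rightarrow> 'e \<Rightarrow> 'e \<Rightarrow> 'e) \<Rightarrow> bool" where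
  "homogeneous_eps_kaehler_structure A g J S \<longleftrightarrow>
     tensor_field_12 A S \<and>
     (\<forall>c\<in>A. \<forall>x\<in>chimg c. let G = (\<lambda>y u v. levi_civita g c y u v - S c y u v) in
        (\<forall>w u v. cov02 G (g c) x w u v = 0) \<and>
        (\<forall>w u v z. cov13 G (curvature g c) x w u v z = 0) \<and>
        (\<forall>w u v. cov12 G (S c) x w u v = 0) \<and>
        (\<forall>w u. cov11 G (J c) x w u = 0))"

definition linear_type_with ::
  "real \<Rightarrow> ('m, 'e::euclidean_space) chart set \<Rightarrow>
    (('m, 'e) chart \<Rightarrow> 'e \<Rightarrow> 'e \<Rightarrow> 'e \<Rightarrow> real) \<Rightarrow> (('m, 'e) chart \<Rightarrow> 'e \<Rightarrow> 'e \<Rightarrow> 'e) \<Rightarrow>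
    (('m, 'e) chart \<Rightarrow> 'e \<Rightarrow> 'e \<Rightarrow> 'e \<Rightarrow> 'e) \<Rightarrow>
    (('m, 'e) chart \<Rightarrow> 'e \<Rightarrow> 'e) \<Rightarrow> (('m, 'e) chart \<Rightarrow> 'e \<Rightarrow> 'e) \<Rightarrow> bool" where
  "linear_type_with \<epsilon> A g J S \<xi> \<zeta> \<longleftrightarrow>
     vector_field A \<xi> \<and> vector_field A \<zeta> \<and>
     (\<forall>c\<in>A. \<forall>x\<in>chimg c. \<forall>u v.
        S c x u v =
          g c x u v *\<^sub>R \<xi> c x - g c x (\<xi> c x) v *\<^sub>R u
          + (\<epsilon> * g c x u (J c x v)) *\<^sub>R J c x (\<xi> c x)
          - (\<epsilon> * g c x (\<xi> c x) (J c x v)) *\<^sub>R J c x u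
          - (2 * g c x (\<zeta> c x) (J c x u)) *\<^sub>R J c x v)"

text \<open>The condition on \<open>\<xi>\<close> is that it is not the zero vector field.\<close>

definition strongly_degenerate_linear_type ::
  "real \<Rightarrow> ('m, 'e::euclidean_space) chart set \<Rightarrow>
    (('m, 'e) chart \<Rightarrow> 'e \<Rightarrow> 'e \<Rightarrow> 'e \<Rightarrow> real) \<Rightarrow> (('m, 'e) chart \<Rightarrow> 'e \<Rightarrow> 'e \<Rightarrow> 'e) \<Rightarrow>
    (('m, 'e) chart \<Rightarrow> 'e \<Rightarrow> 'e \<Rightarrow> 'e \<Rightarrow> 'e) \<Rightarrow> bool" where
  "strongly_degenerate_linear_type \<epsilon> A g J S \<longleftrightarrow>
     (\<exists>\<xi> \<zeta>. linear_type_with \<epsilon> A g J S \<xi> \<zeta> \<and>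
        (\<exists>c\<in>A. \<exists>x\<in>chimg c. \<xi> c x \<noteq> 0) \<and>
        (\<forall>c\<in>A. \<forall>x\<in>chimg c. g c x (\<xi> c x) (\<xi> c x) = 0) \<and>
        (\<forall>c\<in>A. \<forall>x\<in>chimg c. \<zeta> c x = 0))"

end

theory Submission
  imports Defs
begin

text \<open>The connection \<open>\<nabla> - S\<close> leaves \<open>g\<close>, \<open>J\<close> and \<open>S\<close> parallel, hence also \<open>\<xi>\<close>, because a tensor of linear
  type determines its vector field. For strongly degenerate \<open>S\<close> this reads
  \<open>\<nabla>\<^bsub>X\<^esub>\<xi> = g(X,\<xi>) \<xi> + \<epsilon> g(X,J\<xi>) J\<xi>\<close>. So along a geodesic \<open>\<gamma>\<close> the functions \<open>a = g(\<gamma>',\<xi>)\<close> and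
  \<open>b = g(\<gamma>',J\<xi>)\<close> satisfy \<open>a' = a\<^sup>2 + \<epsilon>b\<^sup>2\<close> and \<open>b' = 2ab\<close>, a Riccati equation for \<open>a + b i\<close> with
  \<open>i\<^sup>2 = \<epsilon>\<close>. Its solutions with \<open>a(0) \<noteq> 0\<close>, and \<open>b(0) = 0\<close> if \<open>\<epsilon> = -1\<close>, blow up in finite time, and
  such initial velocities exist wherever \<open>\<xi> \<noteq> 0\<close>.\<close>

subsection \<open>Differential calculus\<close>

text \<open>Differentiating the linear-type formula for \<open>S\<close> by the parallel connection
  replaces \<open>\<xi>\<close> by its covariant derivative \<open>D\<close>, since \<open>g\<close>
  and \<open>J\<close> are parallel; so \<open>D = 0\<close> becomes a pointwise algebraic claim. It
  rests on a nonzero vector orthogonal to \<open>D\<close> and \<open>J D\<close>, hence on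
  dimension above 2. In \<open>S_X \<xi>\<close> the factors \<open>g(\<xi>,\<xi>)\<close> and
  \<open>g(\<xi>,J \<xi>)\<close> vanish, one by degeneracy, the other by skewness. The Riccati
  solution starting at \<open>z\<close> is \<open>z / (1 - t z)\<close>. Over the complex numbers it
  has a pole at a real time only for real nonzero \<open>z\<close>, whence the condition on
  \<open>b(0)\<close>; for \<open>\<epsilon> = 1\<close> the algebra splits into two real lines.
  Much of the work comes from the definition of completeness: it only extends geodesics that are
  already given, so one with prescribed initial velocity has to be constructed. The connection
  coefficients are defined implicitly, so their local Lipschitz continuity is read off from the
  Koszul formula; and \<open>geodesic_on\<close> tests every chart of the atlas, which calls for the
  transformation law of the coefficients.\<close>

lemma linear_euclidean_representation:
  fixes f :: "'a::euclidean_space \<Rightarrow> 'b::real_vector"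
  assumes "linear f"
  shows "(\<Sum>i\<in>Basis. (u \<bullet> i) *\<^sub>R f i) = f u"
  using linear_sum[OF assms, of "\<lambda>i. (u \<bullet> i) *\<^sub>R i" Basis]
  by (simp add: linear_scale[OF assms] euclidean_representation)

text \<open>Tensor components are known to be differentiable only for fixed arguments. In finite
  dimension, expanding \<open>X y\<close> in the basis reduces the product rule to a finite sum of
  scalar multiples.\<close>

lemma has_derivative_linear_family:
  fixes B :: "'a::real_normed_vector \<Rightarrow> 'b::euclidean_space \<Rightarrow> 'c::real_normed_vector"
  assumes lin: "\<forall>\<^sub>F y in nhds x. linear (B y)"
    and B: "\<And>u. ((\<lambda>y. B y u) has_derivative B' u) (at x)"
    and X: "(X has_derivative X') (at x)"
  shows "((\<lambda>y. B y (X y)) has_derivative (\<lambda>w. B' (X x) w + B x (X' w))) (at x)"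
proof -
  have linx: "linear (B x)"
    using lin by (rule eventually_nhds_x_imp_x)
  have ev: "\<forall>\<^sub>F y in at x. (\<Sum>i\<in>Basis. (Y y \<bullet> i) *\<^sub>R B y i) = B y (Y y)" for Y
    using lin by (auto simp: eventually_at_filter linear_euclidean_representation elim!: eventually_mono)
  have D: "((\<lambda>y. B y (Y y)) has_derivative
      (\<lambda>w. \<Sum>i\<in>Basis. (Y x \<bullet> i) *\<^sub>R B' i w + (Y' w \<bullet> i) *\<^sub>R B x i)) (at x)"
    if Y: "(Y has_derivative Y') (at x)" for Y Y'
  proof -
    have "((\<lambda>y. \<Sum>i\<in>Basis. (Y y \<bullet> i) *\<^sub>R B y i) has_derivative
      (\<lambda>w. \<Sum>i\<in>Basis. (Y x \<bullet> i) *\<^sub>R B' i w + (Y' w \<bullet> i) *\<^sub>R B x i)) (at x)"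
      by (intro has_derivative_sum has_derivative_scaleR[OF has_derivative_inner_left[OF Y] B])
    then show ?thesis
      by (rule has_derivative_transform_eventually[OF _ ev]) (simp_all add: linear_euclidean_representation linx)
  qed
  \<comment> \<open>Linearity of \<open>B'\<close> in its first argument is not assumed; it comes
    from applying \<open>D\<close> to the constant field \<open>X x\<close> and comparing with the
    derivative given by \<open>B\<close>.\<close>
  have "B' (X x) w = (\<Sum>i\<in>Basis. (X x \<bullet> i) *\<^sub>R B' i w)" for w
    using fun_cong[OF has_derivative_unique[OF B[of "X x"] D[of "\<lambda>_. X x" "\<lambda>_. 0"]], of w] by simp
  moreover have "B x (X' w) = (\<Sum>i\<in>Basis. (X' w \<bullet> i) *\<^sub>R B x i)" for w
    by (simp add: linear_euclidean_representation linx)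
  ultimately show ?thesis
    using D[OF X] by (simp add: sum.distrib)
qed

lemma has_derivative_bilinear_family:
  fixes B :: "'a::real_normed_vector \<Rightarrow> 'b::euclidean_space \<Rightarrow> 'c::euclidean_space \<Rightarrow> 'd::real_normed_vector"
  assumes lin: "\<forall>\<^sub>F y in nhds x. bilinear (B y)"
    and B: "\<And>u v. ((\<lambda>y. B y u v) has_derivative B' u v) (at x)"
    and X: "(X has_derivative X') (at x)" and Y: "(Y has_derivative Y') (at x)"
  shows "((\<lambda>y. B y (X y) (Y y)) has_derivative
    (\<lambda>w. B' (X x) (Y x) w + B x (X' w) (Y x) + B x (X x) (Y' w))) (at x)"
proof -
  have 1: "((\<lambda>y. B y u (Y y)) has_derivative (\<lambda>w. B' u (Y x) w + B x u (Y' w))) (at x)" for u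
    by (rule has_derivative_linear_family[OF _ B Y])
      (use lin in \<open>auto simp: bilinear_def elim!: eventually_mono\<close>)
  have "((\<lambda>y. B y (X y) (Y y)) has_derivative
    (\<lambda>w. (B' (X x) (Y x) w + B x (X x) (Y' w)) + B x (X' w) (Y x))) (at x)"
    by (rule has_derivative_linear_family[OF _ 1 X])
      (use lin in \<open>auto simp: bilinear_def elim!: eventually_mono\<close>)
  then show ?thesis by (simp add: algebra_simps)
qed

lemma smooth_on_imp_C_k_on: "smooth_on T f \<Longrightarrow> C_k_on k T f"
  by (simp add: smooth_on_def)

lemma smooth_on_dder: "smooth_on T f \<Longrightarrow> smooth_on T (\<lambda>x. dder f x v)"
  unfolding smooth_on_def by (metis C_k_on.simps(2))

lemma smooth_on_has_derivative:
  assumes "smooth_on T f" "x \<in> T"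
  shows "(f has_derivative dder f x) (at x)"
  using smooth_on_imp_C_k_on[OF assms(1), of 1] assms(2) frechet_derivative_works by auto

lemma smooth_on_imp_continuous_on: "smooth_on T f \<Longrightarrow> continuous_on T f"
  using smooth_on_imp_C_k_on[of T f 0] by simp

text \<open>The directional derivatives are continuous, hence bounded on a compact ball. The sum of
  their bounds over the basis dominates the operator norm, and the mean value inequality applies on
  the convex ball.\<close>

lemma smooth_on_imp_lipschitz_on:
  fixes f :: "'a::euclidean_space \<Rightarrow> 'b::real_normed_vector"
  assumes f: "smooth_on T f" and T: "open T" "x \<in> T"
  shows "\<exists>r>0. \<exists>L. L-lipschitz_on (ball x r) f"
proof -
  obtain r where r: "r > 0" "cball x r \<subseteq> T"
    using T open_contains_cball by blast
  have "\<exists>M. \<forall>y\<in>cball x r. norm (dder f y i) \<le> M" for i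
  proof -
    have "compact ((\<lambda>y. dder f y i) ` cball x r)"
      by (intro compact_continuous_image continuous_on_subset[OF _ r(2)]
          smooth_on_imp_continuous_on smooth_on_dder f compact_cball)
    then show ?thesis
      by (meson bounded_iff compact_imp_bounded imageI)
  qed
  then obtain M where M: "\<And>i y. y \<in> cball x r \<Longrightarrow> norm (dder f y i) \<le> M i"
    by metis
  define L where "L = (\<Sum>i\<in>Basis. M i)"
  have onorm: "onorm (dder f y) \<le> L" if y: "y \<in> cball x r" for y
  proof (rule onorm_le)
    fix w
    have lin: "linear (dder f y)"
      using smooth_on_has_derivative[OF f] y r(2) has_derivative_linear by blast
    have "dder f y w = (\<Sum>i\<in>Basis. (w \<bullet> i) *\<^sub>R dder f y i)"
      by (rule linear_euclidean_representation[OF lin, symmetric])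
    also have "norm \<dots> \<le> (\<Sum>i\<in>Basis. norm w * M i)"
      by (rule sum_norm_le) (auto intro!: mult_mono Basis_le_norm M[OF y])
    finally show "norm (dder f y w) \<le> L * norm w"
      by (simp add: L_def sum_distrib_left mult.commute)
  qed
  have "L \<ge> 0"
    unfolding L_def
  proof (rule sum_nonneg)
    show "0 \<le> M i" for i
      using order_trans[OF norm_ge_zero M[of x i]] r(1) by simp
  qed
  have der: "(f has_derivative dder f u) (at u within ball x r)" if "u \<in> ball x r" for u
  proof -
    have "u \<in> T" using that r(2) by (auto simp: subset_iff)
    then show ?thesis by (rule has_derivative_at_withinI[OF smooth_on_has_derivative[OF f]])
  qed
  have "L-lipschitz_on (ball x r) f"
  proof (rule lipschitz_onI[OF _ \<open>L \<ge> 0\<close>])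
    fix y z assume yz: "y \<in> ball x r" "z \<in> ball x r"
    have "norm (f y - f z) \<le> L * norm (y - z)"
      by (rule differentiable_bound[OF convex_ball[of x r] der onorm yz]) auto
    then show "dist (f y) (f z) \<le> L * dist y z" by (simp add: dist_norm)
  qed
  then show ?thesis using r(1) by blast
qed

text \<open>Symmetry of the second derivative: both mixed derivatives are the limit of the second
  difference quotient.\<close>

lemma second_difference:
  fixes f :: "'a::real_normed_vector \<Rightarrow> real"
  assumes T: "open T" "x \<in> T" and f: "\<And>y. y \<in> T \<Longrightarrow> (f has_derivative f' y) (at y)"
    and f': "((\<lambda>y. f' y u) has_derivative f'') (at x)"
  shows "((\<lambda>t. (f (x + t *\<^sub>R u + t *\<^sub>R v) - f (x + t *\<^sub>R u) - f (x + t *\<^sub>R v) + f x) / t\<^sup>2)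
    \<longlongrightarrow> f'' v) (at_right 0)"
proof (rule tendstoI)
  fix e :: real assume e: "e > 0"
  \<comment> \<open>\<open>K\<close> exceeds \<open>norm u + norm v\<close>, and the summand 1 keeps
    it positive when both vectors vanish. All points of the parallelogram with sides
    \<open>t u\<close> and \<open>t v\<close> then lie within \<open>t * K\<close> of
    \<open>x\<close>.\<close>
  define K where "K = 2 * (norm u + norm v) + 1"
  have K: "K > 0" by (simp add: K_def add_nonneg_pos)
  have lin: "linear f''" using f' has_derivative_linear by blast
  obtain d where d: "d > 0" "\<And>y. norm (y - x) < d \<Longrightarrow>
      norm (f' y u - f' x u - f'' (y - x)) \<le> e / (2 * K) * norm (y - x)"
    using f' e K unfolding has_derivative_at_alt by (metis divide_pos_pos mult_pos_pos zero_less_numeral)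
  obtain r where r: "r > 0" "ball x r \<subseteq> T" using T open_contains_ball by blast
  have "\<forall>\<^sub>F t in at_right 0. 0 < t \<and> t < min d r / K"
    using d r K by (intro eventually_conj eventually_at_right_less eventually_at_rightI[of 0 "min d r / K"]) auto
  then show "\<forall>\<^sub>F t in at_right 0.
      dist ((f (x + t *\<^sub>R u + t *\<^sub>R v) - f (x + t *\<^sub>R u) - f (x + t *\<^sub>R v) + f x) / t\<^sup>2) (f'' v) < e"
  proof (rule eventually_mono)
    fix t :: real assume t: "0 < t \<and> t < min d r / K"
    then have tK: "t * K < d" "t * K < r" using K by (auto simp: field_simps)
    have near: "norm (s *\<^sub>R u + q *\<^sub>R v) < t * K" if "0 \<le> s" "s \<le> t" "0 \<le> q" "q \<le> t" for s q
    proof -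
      have "norm (s *\<^sub>R u + q *\<^sub>R v) \<le> s * norm u + q * norm v"
        using norm_triangle_ineq[of "s *\<^sub>R u" "q *\<^sub>R v"] that by simp
      also have "\<dots> \<le> t * norm u + t * norm v"
        using that by (intro add_mono mult_right_mono) auto
      also have "\<dots> < t * K" 
        using t mult_nonneg_nonneg[of t "norm u"] mult_nonneg_nonneg[of t "norm v"]
        by (simp add: K_def algebra_simps add_pos_nonneg)
      finally show ?thesis .
    qed
    \<comment> \<open>The second difference is \<open>\<phi> t - \<phi> 0\<close>. The mean value
      theorem along \<open>u\<close> turns it into a difference of two values of
      \<open>f' y u\<close>, where differentiability at \<open>x\<close> can be used.\<close>
    define \<phi> where "\<phi> s = f (x + s *\<^sub>R u + t *\<^sub>R v) - f (x + s *\<^sub>R u + 0 *\<^sub>R v)" for s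
    have inT: "x + s *\<^sub>R u + q *\<^sub>R v \<in> T" if "0 \<le> s" "s \<le> t" "0 \<le> q" "q \<le> t" for s q
    proof -
      have "dist x (x + s *\<^sub>R u + q *\<^sub>R v) = norm (s *\<^sub>R u + q *\<^sub>R v)"
        by (metis add.assoc add_diff_cancel_left' dist_commute dist_norm)
      then show ?thesis using near[OF that] tK r(2) by (auto simp: subset_iff)
    qed
    have fl: "linear (f' y)" if "y \<in> T" for y using f[OF that] has_derivative_linear by blast
    have der: "((\<lambda>s. f (x + s *\<^sub>R u + q *\<^sub>R v)) has_real_derivative f' (x + s *\<^sub>R u + q *\<^sub>R v) u) (at s)"
      if "0 \<le> s" "s \<le> t" "0 \<le> q" "q \<le> t" for s q
    proof -
      have "((\<lambda>s. x + s *\<^sub>R u + q *\<^sub>R v) has_derivative (\<lambda>h. h *\<^sub>R u)) (at s)"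
        by (auto intro!: derivative_eq_intros)
      from has_derivative_compose[OF this f[OF inT[OF that]]]
      show ?thesis
        unfolding has_field_derivative_def
        by (simp add: linear_scale[OF fl[OF inT[OF that]]] mult_commute_abs)
    qed
    have "\<exists>s. 0 < s \<and> s < t \<and> \<phi> t - \<phi> 0 = (t - 0) * (f' (x + s *\<^sub>R u + t *\<^sub>R v) u - f' (x + s *\<^sub>R u + 0 *\<^sub>R v) u)"
      unfolding \<phi>_def using t by (intro MVT2 DERIV_diff der) auto
    then obtain s where s: "0 < s" "s < t"
      and \<phi>: "\<phi> t - \<phi> 0 = t * (f' (x + s *\<^sub>R u + t *\<^sub>R v) u - f' (x + s *\<^sub>R u + 0 *\<^sub>R v) u)" by auto
    let ?E = "\<lambda>q. f' (x + s *\<^sub>R u + q *\<^sub>R v) u - f' x u - f'' (s *\<^sub>R u + q *\<^sub>R v)"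
    have E: "\<bar>?E q\<bar> < e / 2 * t" if "0 \<le> q" "q \<le> t" for q
    proof -
      have n: "norm (s *\<^sub>R u + q *\<^sub>R v) < t * K" using near s that by simp
      have "\<bar>?E q\<bar> \<le> e / (2 * K) * norm (s *\<^sub>R u + q *\<^sub>R v)"
        using d(2)[of "x + s *\<^sub>R u + q *\<^sub>R v"] n tK by (simp add: add.assoc)
      also have "\<dots> < e / (2 * K) * (t * K)"
        using n e K by (intro mult_strict_left_mono) auto
      also have "\<dots> = e / 2 * t" using K by simp
      finally show ?thesis .
    qed
    \<comment> \<open>The linear parts at the two points differ by \<open>t * f'' v\<close>; what
      remains are two remainders, each below \<open>e / 2 * t\<close>.\<close>
    have "\<phi> t - \<phi> 0 = t * (?E t - ?E 0 + t * f'' v)"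
      unfolding \<phi> by (simp add: linear_add[OF lin] linear_scale[OF lin])
    moreover have aux: "t * (A + t * B) / t\<^sup>2 - B = A / t" for A B
      using t by (simp add: power2_eq_square field_simps)
    ultimately have "(\<phi> t - \<phi> 0) / t\<^sup>2 - f'' v = (?E t - ?E 0) / t"
      using aux t by simp
    moreover have "\<bar>?E t - ?E 0\<bar> < e * t" using E[of t] E[of 0] t by linarith
    ultimately have "\<bar>(\<phi> t - \<phi> 0) / t\<^sup>2 - f'' v\<bar> < e"
      using t by (simp add: abs_divide pos_divide_less_eq)
    then show "dist ((f (x + t *\<^sub>R u + t *\<^sub>R v) - f (x + t *\<^sub>R u) - f (x + t *\<^sub>R v) + f x) / t\<^sup>2) (f'' v) < e"
      by (simp add: \<phi>_def dist_real_def algebra_simps)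
  qed
qed

lemma smooth_on_second_derivative_symmetric:
  fixes f :: "'a::real_normed_vector \<Rightarrow> 'b::euclidean_space"
  assumes f: "smooth_on T f" and T: "open T" "x \<in> T"
  shows "dder (\<lambda>y. dder f y u) x v = dder (\<lambda>y. dder f y v) x u"
proof (rule euclidean_eqI)
  fix i :: 'b assume "i \<in> Basis"
  have 1: "((\<lambda>y. f y \<bullet> i) has_derivative (\<lambda>w. dder f y w \<bullet> i)) (at y)" if "y \<in> T" for y
    using smooth_on_has_derivative[OF f that] by (rule has_derivative_inner_left)
  have 2: "((\<lambda>y. dder f y u \<bullet> i) has_derivative (\<lambda>w. dder (\<lambda>y. dder f y u) x w \<bullet> i)) (at x)" for u
    using smooth_on_has_derivative[OF smooth_on_dder[OF f] T(2)] by (rule has_derivative_inner_left)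
  note L = second_difference[OF T 1 2]
  show "dder (\<lambda>y. dder f y u) x v \<bullet> i = dder (\<lambda>y. dder f y v) x u \<bullet> i"
    using L[of u v] L[of v u]
    by (intro tendsto_unique[OF trivial_limit_at_right_real]) (simp_all add: algebra_simps)
qed

subsection \<open>Ordinary differential equations\<close>

text \<open>A complete normed field covers real and complex solutions at once. A nonzero real
  initial value \<open>r\<close> puts the pole of the expected solution at the real time
  \<open>t0 + 1 / r\<close>. No blow-up estimate is made: at that time the defect \<open>q\<close>
  equals \<open>- r\<close>, whereas a linear equation with zero initial value forces it to
  vanish.\<close>

lemma riccati_no_global_solution:
  fixes w :: "real \<Rightarrow> 'a::{real_normed_field,banach}"
  assumes w: "\<And>t. (w has_vector_derivative (w t)\<^sup>2) (at t)"
    and w0: "w t0 = of_real r"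
  shows "r = 0"
proof (rule ccontr)
  assume r: "r \<noteq> 0"
  \<comment> \<open>The compact interval contains \<open>t0 + 1 / r\<close> for either sign of
    \<open>r\<close>, and the continuous \<open>w\<close> has an antiderivative on it.\<close>
  define a b where "a = t0 - 1 / \<bar>r\<bar>" and "b = t0 + 1 / \<bar>r\<bar>"
  have "continuous_on UNIV w"
    using w by (metis continuous_at_imp_continuous_on has_vector_derivative_continuous)
  then have "continuous_on {a..b} w" by (rule continuous_on_subset) simp
  then obtain W where W: "\<And>t. t \<in> {a..b} \<Longrightarrow> (W has_vector_derivative w t) (at t within {a..b})"
    using antiderivative_continuous by blast
  text \<open>The solution should be \<open>r / (1 - (t - t0) r)\<close>; the defect \<open>q\<close> solves \<open>q' = w q\<close>.\<close>
  define q where "q t = w t * of_real (1 - (t - t0) * r) - of_real r" for t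
  have q: "(q has_vector_derivative w t * q t) (at t within {a..b})" for t
    unfolding q_def
    by (rule derivative_eq_intros has_vector_derivative_at_within[OF w] refl)+
      (simp add: algebra_simps power2_eq_square)
  \<comment> \<open>\<open>exp (- W t)\<close> is the integrating factor of the linear equation for
    \<open>q\<close>.\<close>
  have E: "((\<lambda>t. q t * exp (- W t)) has_vector_derivative 0) (at t within {a..b})" if "t \<in> {a..b}" for t
  proof -
    have "((\<lambda>t. exp (- W t)) has_vector_derivative - w t * exp (- W t)) (at t within {a..b})"
      using field_vector_diff_chain_within[OF has_vector_derivative_minus[OF W[OF that]], of exp "exp (- W t)"]
      by (simp add: o_def DERIV_subset[OF DERIV_exp])
    from has_vector_derivative_mult[OF q this] show ?thesis
      by (simp add: algebra_simps)
  qed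
  have "\<exists>c. \<forall>t\<in>{a..b}. q t * exp (- W t) = c"
    using has_vector_derivative_zero_constant[of "{a..b}" "\<lambda>t. q t * exp (- W t)"] E by (metis convex_real_interval(5))
  moreover have "t0 \<in> {a..b}" "t0 + 1 / r \<in> {a..b}"
    by (auto simp: a_def b_def abs_if)
  moreover have "q t0 = 0" by (simp add: q_def w0)
  ultimately have "q (t0 + 1 / r) * exp (- W (t0 + 1 / r)) = 0" by (metis mult_zero_left)
  then have "q (t0 + 1 / r) = 0" by simp
  then show False using r by (simp add: q_def)
qed

text \<open>Banach's fixed point theorem for the integral operator \<open>P\<close>. Clamping time
  to \<open>{-\<delta>..\<delta>}\<close> by \<open>cl\<close> lets \<open>P\<close> act on bounded
  continuous functions on the whole line, where the functions with values in the closed ball form a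
  complete set.\<close>

lemma picard_lindelof_local:
  fixes F :: "'a::banach \<Rightarrow> 'a"
  assumes r: "r > 0" and F: "L-lipschitz_on (cball z0 r) F"
  shows "\<exists>\<delta>>0. \<exists>z. z 0 = z0 \<and>
    (\<forall>t\<in>{-\<delta><..<\<delta>}. z t \<in> cball z0 r \<and> (z has_vector_derivative F (z t)) (at t))"
proof -
  have L: "L \<ge> 0" using F by (rule lipschitz_on_nonneg)
  define M where "M = norm (F z0) + L * r"
  have M: "norm (F y) \<le> M" if "y \<in> cball z0 r" for y
  proof -
    have "norm (F y - F z0) \<le> L * norm (y - z0)"
      using lipschitz_on_normD[OF F that] r by simp
    also have "\<dots> \<le> L * r" using that L by (intro mult_left_mono) (auto simp: dist_norm norm_minus_commute)
    finally show ?thesis using norm_triangle_ineq2[of "F y" "F z0"] by (simp add: M_def)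
  qed
  have M0: "M \<ge> 0" using r L by (simp add: M_def)
  \<comment> \<open>The first bound keeps \<open>P\<close> inside the ball, as \<open>M\<close>
    bounds \<open>F\<close> there; the second makes \<open>P\<close> a contraction with factor 1/2.
    The added 1's keep the denominators positive.\<close>
  define \<delta> where "\<delta> = min (r / (M + 1)) (1 / (2 * (L + 1)))"
  have \<delta>: "\<delta> > 0" "\<delta> * M \<le> r" "\<delta> * L \<le> 1/2"
  proof -
    show "\<delta> > 0" using r M0 L by (simp add: \<delta>_def)
    have "\<delta> * M \<le> r / (M + 1) * M" using M0 by (intro mult_right_mono) (auto simp: \<delta>_def)
    also have "\<dots> \<le> r" using M0 r by (simp add: field_simps)
    finally show "\<delta> * M \<le> r" .
    have "\<delta> * L \<le> 1 / (2 * (L + 1)) * L" using L by (intro mult_right_mono) (auto simp: \<delta>_def)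
    also have "\<dots> \<le> 1/2" using L by (simp add: field_simps)
    finally show "\<delta> * L \<le> 1/2" .
  qed
  define cl where "cl t = max (-\<delta>) (min t \<delta>)" for t
  have cl: "cl t \<in> {-\<delta>..\<delta>}" for t using \<delta>(1) by (auto simp: cl_def)
  \<comment> \<open>The integral over \<open>{0..t}\<close> is zero for negative \<open>t\<close>.
    The difference of integrals from the common base point \<open>-\<delta>\<close> is the oriented
    integral from 0 to \<open>t\<close>.\<close>
  define I where "I f t = integral {-\<delta>..t} f - integral {-\<delta>..0} f" for f :: "real \<Rightarrow> 'a" and t
  have I_bound: "norm (I f t) \<le> \<delta> * B"
    if t: "t \<in> {-\<delta>..\<delta>}" and f: "continuous_on {-\<delta>..\<delta>} f"
      and B: "\<And>s. s \<in> {-\<delta>..\<delta>} \<Longrightarrow> norm (f s) \<le> B" for f t B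
  proof -
    have B0: "B \<ge> 0" using order_trans[OF norm_ge_zero B[of 0]] \<delta>(1) by simp
    have io: "f integrable_on {a..b}" if "{a..b} \<subseteq> {-\<delta>..\<delta>}" for a b
      using f that continuous_on_subset integrable_continuous_real by blast
    have ib: "norm (integral {a..b} f) \<le> \<delta> * B" if "{a..b} \<subseteq> {-\<delta>..\<delta>}" "a \<le> b" "b - a \<le> \<delta>" for a b
    proof -
      have "norm (integral {a..b} f) \<le> B * (b - a)"
        using f that B by (intro integral_bound continuous_on_subset[OF f]) auto
      also have "\<dots> \<le> B * \<delta>" using B0 that by (intro mult_left_mono) auto
      finally show ?thesis by (simp add: mult.commute)
    qed
    show ?thesis
    proof (cases "t \<ge> 0")
      case True
      have "I f t = integral {0..t} f"
        unfolding I_def using Henstock_Kurzweil_Integration.integral_combine[of "-\<delta>" 0 t f] io[of "-\<delta>" t] t True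
        by (simp add: algebra_simps)
      then show ?thesis using ib[of 0 t] t True \<delta>(1) by simp
    next
      case False
      have "I f t = - integral {t..0} f"
        unfolding I_def using Henstock_Kurzweil_Integration.integral_combine[of "-\<delta>" t 0 f] io[of "-\<delta>" 0] t False \<delta>(1)
        by (simp add: algebra_simps)
      then show ?thesis using ib[of t 0] t False \<delta>(1) by simp
    qed
  qed
  define X :: "(real \<Rightarrow>\<^sub>C 'a) set" where "X = PiC UNIV (\<lambda>_. cball z0 r)"
  have X: "apply_bcontfun \<phi> t \<in> cball z0 r" if "\<phi> \<in> X" for \<phi> t
    using that by (auto simp: X_def mem_PiC_iff)
  have Fc: "continuous_on {-\<delta>..\<delta>} (\<lambda>s. F (apply_bcontfun \<phi> s))" if "\<phi> \<in> X" for \<phi>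
    by (rule continuous_on_compose2[OF lipschitz_on_continuous_on[OF F]]) (use X[OF that] in auto)
  define P where "P \<phi> t = z0 + I (\<lambda>s. F (apply_bcontfun \<phi> s)) (cl t)" for \<phi> t
  have P_in: "P \<phi> t \<in> cball z0 r" if "\<phi> \<in> X" for \<phi> t
    using I_bound[OF cl Fc[OF that], of M t] M X[OF that] \<delta>(2) by (auto simp: P_def dist_norm)
  have P_cont: "continuous_on UNIV (P \<phi>)" if "\<phi> \<in> X" for \<phi>
  proof -
    have "continuous_on {-\<delta>..\<delta>} (\<lambda>t. integral {-\<delta>..t} (\<lambda>s. F (apply_bcontfun \<phi> s)))"
      using Fc[OF that] by (intro indefinite_integral_continuous_1 integrable_continuous_real)
    then have "continuous_on UNIV (\<lambda>t. integral {-\<delta>..cl t} (\<lambda>s. F (apply_bcontfun \<phi> s)))"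
      by (rule continuous_on_compose2) (use cl in \<open>auto simp: cl_def[abs_def] intro!: continuous_intros\<close>)
    then show ?thesis unfolding P_def I_def by (intro continuous_intros)
  qed
  have P_app: "apply_bcontfun (Bcontfun (P \<phi>)) = P \<phi>" if "\<phi> \<in> X" for \<phi>
  proof (rule Bcontfun_inverse)
    have "bounded (range (P \<phi>))"
      using P_in[OF that] by (intro bounded_subset[OF bounded_cball[of z0 r]]) auto
    then show "P \<phi> \<in> bcontfun" using P_cont[OF that] by (simp add: bcontfun_def)
  qed
  have "complete X" unfolding X_def by (intro closed_PiC[THEN complete_eq_closed[THEN iffD2]]) auto
  moreover have "X \<noteq> {}"
  proof -
    have "const_bcontfun z0 \<in> X" using r by (auto simp: X_def mem_PiC_iff)
    then show ?thesis by blast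
  qed
  moreover have "(\<lambda>\<phi>. Bcontfun (P \<phi>)) ` X \<subseteq> X"
    using P_in by (auto simp: X_def[symmetric] P_app) (auto simp: X_def mem_PiC_iff P_app[unfolded X_def])
  moreover have "dist (Bcontfun (P \<phi>)) (Bcontfun (P \<psi>)) \<le> 1/2 * dist \<phi> \<psi>" if "\<phi> \<in> X" "\<psi> \<in> X" for \<phi> \<psi>
  proof (rule dist_bound)
    fix t
    let ?f = "\<lambda>s. F (apply_bcontfun \<phi> s)" and ?g = "\<lambda>s. F (apply_bcontfun \<psi> s)"
    have "I ?f u - I ?g u = I (\<lambda>s. ?f s - ?g s) u" if "u \<in> {-\<delta>..\<delta>}" for u
    proof -
      have "?f integrable_on {-\<delta>..b} \<and> ?g integrable_on {-\<delta>..b}" if "b \<in> {-\<delta>..\<delta>}" for b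
        using that Fc[OF \<open>\<phi> \<in> X\<close>] Fc[OF \<open>\<psi> \<in> X\<close>]
        by (auto intro!: integrable_continuous_real elim!: continuous_on_subset)
      from this[OF that] this[of 0] show ?thesis
        using \<delta>(1) by (simp add: I_def Henstock_Kurzweil_Integration.integral_diff)
    qed
    then have "dist (P \<phi> t) (P \<psi> t) = norm (I (\<lambda>s. ?f s - ?g s) (cl t))"
      using cl by (simp add: P_def dist_norm)
    also have "\<dots> \<le> \<delta> * (L * dist \<phi> \<psi>)"
    proof (rule I_bound[OF cl])
      show "continuous_on {-\<delta>..\<delta>} (\<lambda>s. ?f s - ?g s)"
        using Fc that by (intro continuous_intros) auto
      fix s
      have "norm (?f s - ?g s) \<le> L * norm (apply_bcontfun \<phi> s - apply_bcontfun \<psi> s)"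
        using lipschitz_on_normD[OF F X[OF that(1)] X[OF that(2)]] by simp
      also have "\<dots> \<le> L * dist \<phi> \<psi>"
        using L dist_bounded[of \<phi> s \<psi>] by (intro mult_left_mono) (auto simp: dist_norm)
      finally show "norm (?f s - ?g s) \<le> L * dist \<phi> \<psi>" .
    qed
    also have "\<dots> \<le> 1/2 * dist \<phi> \<psi>"
      using mult_right_mono[OF \<delta>(3), of "dist \<phi> \<psi>"] by (simp add: mult.assoc)
    finally show "dist (apply_bcontfun (Bcontfun (P \<phi>)) t) (apply_bcontfun (Bcontfun (P \<psi>)) t) \<le> 1/2 * dist \<phi> \<psi>"
      by (simp add: P_app that)
  qed
  ultimately obtain \<phi> where \<phi>: "\<phi> \<in> X" "Bcontfun (P \<phi>) = \<phi>"
    using Banach_fix[of X "1/2" "\<lambda>\<phi>. Bcontfun (P \<phi>)"] by auto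
  define z where "z = apply_bcontfun \<phi>"
  have z: "z = P \<phi>" using \<phi> P_app[OF \<phi>(1)] by (simp add: z_def)
  have "z 0 = z0" unfolding z using \<delta>(1) by (simp add: P_def I_def cl_def)
  moreover have "z t \<in> cball z0 r" for t using X[OF \<phi>(1)] by (simp add: z_def)
  moreover have "(z has_vector_derivative F (z t)) (at t)" if t: "t \<in> {-\<delta><..<\<delta>}" for t
  proof -
    have "((\<lambda>u. integral {-\<delta>..u} (\<lambda>s. F (z s))) has_vector_derivative F (z t)) (at t within {-\<delta>..\<delta>})"
      using integral_has_vector_derivative[OF Fc[OF \<phi>(1)]] t by (simp add: z_def)
    moreover have "at t within {-\<delta>..\<delta>} = at t"
      using t by (intro at_within_interior) (simp add: interior_atLeastAtMost_real)
    ultimately have "((\<lambda>u. integral {-\<delta>..u} (\<lambda>s. F (z s))) has_vector_derivative F (z t)) (at t)"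
      by metis
    then have "((\<lambda>u. z0 + I (\<lambda>s. F (z s)) u) has_vector_derivative F (z t)) (at t)"
      unfolding I_def
      using has_vector_derivative_add[OF has_vector_derivative_const has_vector_derivative_diff[OF _ has_vector_derivative_const]]
      by force
    moreover have "z0 + I (\<lambda>s. F (z s)) u = z u" if "u \<in> {-\<delta><..<\<delta>}" for u
      using that P_def[of \<phi> u] fun_cong[OF z, of u] by (simp add: cl_def z_def[symmetric])
    ultimately show ?thesis
      using has_vector_derivative_transform_within_open[of _ _ t "{-\<delta><..<\<delta>}" z] t
      by (metis open_greaterThanLessThan)
  qed
  ultimately show ?thesis using \<delta>(1) by blast
qed

subsection \<open>Locally Lipschitz functions\<close>

text \<open>Just the regularity that the Picard iteration consumes. Being pointwise, it passes
  through sums, bilinear products, compositions and, below, the solution of linear systems.\<close>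

definition lipschitz_near :: "('a::real_normed_vector \<Rightarrow> 'b::real_normed_vector) \<Rightarrow> 'a \<Rightarrow> bool" where
  "lipschitz_near f x \<longleftrightarrow> (\<exists>r>0. \<exists>L. L-lipschitz_on (ball x r) f)"

lemma lipschitz_nearE:
  assumes "lipschitz_near f x"
  obtains r L where "r > 0" "L \<ge> 0"
    "\<And>y z. y \<in> ball x r \<Longrightarrow> z \<in> ball x r \<Longrightarrow> norm (f y - f z) \<le> L * norm (y - z)"
    "\<And>y. y \<in> ball x r \<Longrightarrow> norm (f y) \<le> norm (f x) + L * r"
proof -
  obtain r L where r: "r > 0" and L: "L-lipschitz_on (ball x r) f"
    using assms lipschitz_near_def by blast
  have 1: "norm (f y - f z) \<le> L * norm (y - z)" if "y \<in> ball x r" "z \<in> ball x r" for y z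
    using lipschitz_on_normD[OF L that] .
  have 2: "norm (f y) \<le> norm (f x) + L * r" if y: "y \<in> ball x r" for y
  proof -
    have "norm (f y - f x) \<le> L * norm (y - x)" using 1 y r by simp
    also have "\<dots> \<le> L * r"
      using y lipschitz_on_nonneg[OF L]
      by (intro mult_left_mono) (auto simp: dist_norm norm_minus_commute)
    finally show ?thesis using norm_triangle_ineq2[of "f y" "f x"] by simp
  qed
  show ?thesis using that[OF r lipschitz_on_nonneg[OF L] 1 2] .
qed

lemma lipschitz_nearI:
  assumes "r > 0" "L \<ge> 0"
    and "\<And>y z. y \<in> ball x r \<Longrightarrow> z \<in> ball x r \<Longrightarrow> norm (f y - f z) \<le> L * norm (y - z)"
  shows "lipschitz_near f x"
proof -
  have "L-lipschitz_on (ball x r) f"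
    using assms(2,3) by (intro lipschitz_onI) (simp_all only: dist_norm)
  then show ?thesis using assms(1) lipschitz_near_def by blast
qed

lemma lipschitz_near_cong:
  assumes f: "lipschitz_near f x" and eq: "\<forall>\<^sub>F y in nhds x. f y = g y"
  shows "lipschitz_near g x"
proof -
  obtain r L where L: "r > 0" "L \<ge> 0"
    "\<And>y z. y \<in> ball x r \<Longrightarrow> z \<in> ball x r \<Longrightarrow> norm (f y - f z) \<le> L * norm (y - z)"
    using lipschitz_nearE[OF f] by metis
  obtain e where e: "e > 0" "\<And>y. y \<in> ball x e \<Longrightarrow> f y = g y"
    using eq unfolding eventually_nhds_metric by (metis dist_commute mem_ball)
  show ?thesis
    by (rule lipschitz_nearI[of "min r e" L]) (use L e in \<open>auto simp flip: e(2)\<close>)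
qed

lemma lipschitz_near_bounded_bilinear:
  assumes p: "bounded_bilinear p" and f: "lipschitz_near f x" and g: "lipschitz_near g x"
  shows "lipschitz_near (\<lambda>y. p (f y) (g y)) x"
proof -
  interpret bounded_bilinear p by (rule p)
  obtain r L where r: "r > 0" "L \<ge> 0"
    "\<And>y z. y \<in> ball x r \<Longrightarrow> z \<in> ball x r \<Longrightarrow> norm (f y - f z) \<le> L * norm (y - z)"
    "\<And>y. y \<in> ball x r \<Longrightarrow> norm (f y) \<le> norm (f x) + L * r"
    using lipschitz_nearE[OF f] by metis
  obtain s M where s: "s > 0" "M \<ge> 0"
    "\<And>y z. y \<in> ball x s \<Longrightarrow> z \<in> ball x s \<Longrightarrow> norm (g y - g z) \<le> M * norm (y - z)"
    "\<And>y. y \<in> ball x s \<Longrightarrow> norm (g y) \<le> norm (g x) + M * s"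
    using lipschitz_nearE[OF g] by metis
  obtain K where K: "K \<ge> 0" "\<And>a b. norm (p a b) \<le> norm a * norm b * K"
    using nonneg_bounded by blast
  let ?F = "norm (f x) + L * r" and ?G = "norm (g x) + M * s"
  show ?thesis
  proof (rule lipschitz_nearI[of "min r s" "L * ?G * K + ?F * M * K"])
    fix y z assume yz: "y \<in> ball x (min r s)" "z \<in> ball x (min r s)"
    have "p (f y) (g y) - p (f z) (g z) = p (f y - f z) (g y) + p (f z) (g y - g z)"
      by (simp add: diff_left diff_right)
    also have "norm \<dots> \<le> norm (f y - f z) * norm (g y) * K + norm (f z) * norm (g y - g z) * K"
      by (intro norm_triangle_le add_mono K)
    also have "\<dots> \<le> L * norm (y - z) * ?G * K + ?F * (M * norm (y - z)) * K"
      using r s K yz by (intro add_mono mult_mono) auto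
    finally show "norm (p (f y) (g y) - p (f z) (g z)) \<le> (L * ?G * K + ?F * M * K) * norm (y - z)"
      by (simp add: algebra_simps)
  qed (use r s K in auto)
qed

lemma lipschitz_near_const: "lipschitz_near (\<lambda>_. k) x"
  by (rule lipschitz_nearI[of 1 0]) auto

lemma lipschitz_near_add:
  assumes f: "lipschitz_near f x" and g: "lipschitz_near g x"
  shows "lipschitz_near (\<lambda>y. f y + g y) x"
proof -
  obtain r L where r: "r > 0" "L \<ge> 0"
    "\<And>y z. y \<in> ball x r \<Longrightarrow> z \<in> ball x r \<Longrightarrow> norm (f y - f z) \<le> L * norm (y - z)"
    using lipschitz_nearE[OF f] by metis
  obtain s M where s: "s > 0" "M \<ge> 0"
    "\<And>y z. y \<in> ball x s \<Longrightarrow> z \<in> ball x s \<Longrightarrow> norm (g y - g z) \<le> M * norm (y - z)"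
    using lipschitz_nearE[OF g] by metis
  show ?thesis
  proof (rule lipschitz_nearI[of "min r s" "L + M"])
    fix y z assume "y \<in> ball x (min r s)" "z \<in> ball x (min r s)"
    then have "norm (f y - f z) + norm (g y - g z) \<le> (L + M) * norm (y - z)"
      using r(3)[of y z] s(3)[of y z] by (simp add: distrib_right)
    then show "norm (f y + g y - (f z + g z)) \<le> (L + M) * norm (y - z)"
      by (metis add_diff_add norm_triangle_ineq order_trans)
  qed (use r s in auto)
qed

lemma lipschitz_near_sum:
  assumes "finite I" "\<And>i. i \<in> I \<Longrightarrow> lipschitz_near (f i) x"
  shows "lipschitz_near (\<lambda>y. \<Sum>i\<in>I. f i y) x"
  using assms by (induction I rule: finite_induct) (auto intro: lipschitz_near_const lipschitz_near_add)

lemma lipschitz_near_compose: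
  assumes f: "lipschitz_near f (g x)" and g: "lipschitz_near g x"
  shows "lipschitz_near (\<lambda>y. f (g y)) x"
proof -
  obtain r L where r: "r > 0" "L \<ge> 0"
    "\<And>y z. y \<in> ball (g x) r \<Longrightarrow> z \<in> ball (g x) r \<Longrightarrow> norm (f y - f z) \<le> L * norm (y - z)"
    using lipschitz_nearE[OF f] by metis
  obtain s M where s: "s > 0" "M \<ge> 0"
    "\<And>y z. y \<in> ball x s \<Longrightarrow> z \<in> ball x s \<Longrightarrow> norm (g y - g z) \<le> M * norm (y - z)"
    using lipschitz_nearE[OF g] by metis
  define t where "t = min s (r / (M + 1))"
  have t: "t > 0" using r s by (simp add: t_def)
  have into: "g y \<in> ball (g x) r" if y: "y \<in> ball x t" for y
  proof -
    have "norm (g x - g y) \<le> M * norm (x - y)" using s y t by (auto simp: t_def)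
    also have "\<dots> \<le> M * (r / (M + 1))"
      using y s by (intro mult_left_mono) (auto simp: t_def dist_norm)
    also have "\<dots> < r" using r s by (simp add: field_simps)
    finally show ?thesis by (simp add: dist_norm)
  qed
  show ?thesis
  proof (rule lipschitz_nearI[of t "L * M"])
    fix y z assume yz: "y \<in> ball x t" "z \<in> ball x t"
    have "norm (f (g y) - f (g z)) \<le> L * norm (g y - g z)" using r into yz by blast
    also have "\<dots> \<le> L * (M * norm (y - z))"
      using s(3)[of y z] r(2) yz by (intro mult_left_mono) (auto simp: t_def)
    finally show "norm (f (g y) - f (g z)) \<le> L * M * norm (y - z)" by simp
  qed (use t r s in auto)
qed

lemma lipschitz_near_bounded_linear: "bounded_linear f \<Longrightarrow> lipschitz_near f x"
  unfolding lipschitz_near_def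
  by (metis bounded_linear.lipschitz_boundE lipschitz_on_subset subset_UNIV zero_less_one)

lemma lipschitz_near_Pair:
  assumes "lipschitz_near f x" "lipschitz_near g x"
  shows "lipschitz_near (\<lambda>y. (f y, g y)) x"
proof -
  have 1: "lipschitz_near (\<lambda>y. (f y, 0)) x"
    by (rule lipschitz_near_compose[OF lipschitz_near_bounded_linear assms(1)])
      (intro bounded_linear_Pair bounded_linear_ident bounded_linear_zero)
  have 2: "lipschitz_near (\<lambda>y. (0, g y)) x"
    by (rule lipschitz_near_compose[OF lipschitz_near_bounded_linear assms(2)])
      (intro bounded_linear_Pair bounded_linear_ident bounded_linear_zero)
  show ?thesis using lipschitz_near_add[OF 1 2] by simp
qed

text \<open>No inverse operator is formed: the lower bound \<open>c\<close> of \<open>A x\<close>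
  survives as \<open>c / 2\<close> for nearby \<open>A y\<close>, which bounds \<open>G\<close> and
  then its differences.\<close>

lemma lipschitz_near_linear_solution:
  fixes A :: "'a::real_normed_vector \<Rightarrow> 'b::real_normed_vector \<Rightarrow>\<^sub>L 'c::real_normed_vector"
  assumes A: "lipschitz_near A x" and k: "lipschitz_near k x"
    and sol: "\<forall>\<^sub>F y in nhds x. A y (G y) = k y"
    and c: "c > 0" "\<And>w. c * norm w \<le> norm (A x w)"
  shows "lipschitz_near G x"
proof -
  obtain r L where r: "r > 0" "L \<ge> 0"
    "\<And>y z. y \<in> ball x r \<Longrightarrow> z \<in> ball x r \<Longrightarrow> norm (A y - A z) \<le> L * norm (y - z)"
    using lipschitz_nearE[OF A] by metis
  obtain s M where s: "s > 0" "M \<ge> 0"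
    "\<And>y z. y \<in> ball x s \<Longrightarrow> z \<in> ball x s \<Longrightarrow> norm (k y - k z) \<le> M * norm (y - z)"
    "\<And>y. y \<in> ball x s \<Longrightarrow> norm (k y) \<le> norm (k x) + M * s"
    using lipschitz_nearE[OF k] by metis
  obtain e where e: "e > 0" "\<And>y. y \<in> ball x e \<Longrightarrow> A y (G y) = k y"
    using sol unfolding eventually_nhds_metric by (metis dist_commute mem_ball)
  \<comment> \<open>The last radius makes \<open>norm (A x - A y)\<close> at most
    \<open>c / 2\<close>.\<close>
  define t where "t = min (min r s) (min e (c / (2 * (L + 1))))"
  have t: "t > 0" using r s e c by (simp add: t_def)
  have low: "c / 2 * norm w \<le> norm (A y w)" if y: "y \<in> ball x t" for y w
  proof -
    have "L * norm (x - y) \<le> L * (c / (2 * (L + 1)))"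
      using y r by (intro mult_left_mono) (auto simp: t_def dist_norm)
    also have "\<dots> \<le> c / 2" using r c by (simp add: field_simps)
    finally have "norm (A x - A y) \<le> c / 2"
      using r(3)[of x y] y t by (auto simp: t_def)
    then have "norm ((A x - A y) w) \<le> c / 2 * norm w"
      by (meson norm_blinfun mult_right_mono norm_ge_zero order_trans)
    then show ?thesis
      using c(2)[of w] norm_triangle_ineq2[of "A x w" "A y w"] by (simp add: blinfun.diff_left)
  qed
  define K where "K = norm (k x) + M * s"
  have K: "K \<ge> 0" using s by (simp add: K_def)
  have G: "norm (G y) \<le> 2 * K / c" if y: "y \<in> ball x t" for y
  proof -
    have "c / 2 * norm (G y) \<le> K"
      using low[OF y, of "G y"] e(2)[of y] s(4)[of y] y by (auto simp: t_def K_def)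
    then show ?thesis using c by (simp add: field_simps)
  qed
  show ?thesis
  proof (rule lipschitz_nearI[of t "2 / c * (M + L * (2 * K / c))"])
    fix y z assume yz: "y \<in> ball x t" "z \<in> ball x t"
    \<comment> \<open>Subtracting the equations at \<open>y\<close> and \<open>z\<close> leaves the
      difference of right sides plus the change of the operator applied to the bounded
      \<open>G z\<close>.\<close>
    have "A y (G y - G z) = (k y - k z) + (A z - A y) (G z)"
      using e(2)[of y] e(2)[of z] yz by (simp add: t_def blinfun.diff_left blinfun.diff_right)
    also have "norm \<dots> \<le> norm (k y - k z) + norm (A z - A y) * norm (G z)"
      by (intro norm_triangle_le add_mono norm_blinfun order_refl)
    also have "\<dots> \<le> M * norm (y - z) + L * norm (z - y) * (2 * K / c)"
      using yz r s G[OF yz(2)] by (intro add_mono mult_mono) (auto simp: t_def)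
    also have "\<dots> = (M + L * (2 * K / c)) * norm (y - z)"
      by (simp only: norm_minus_commute[of z]) algebra
    finally have "c / 2 * norm (G y - G z) \<le> (M + L * (2 * K / c)) * norm (y - z)"
      using low[OF yz(1), of "G y - G z"] by linarith
    then show "norm (G y - G z) \<le> 2 / c * (M + L * (2 * K / c)) * norm (y - z)"
      using c by (simp add: field_simps)
  qed (use t s r K c in auto)
qed

text \<open>Testing against basis vectors makes the implicit equation a linear system with the
  matrix of \<open>B y\<close>. Nondegeneracy at \<open>x\<close> alone makes the operator injective
  there, and in finite dimension injectivity gives the lower bound.\<close>

lemma lipschitz_near_representation:
  fixes B :: "'a::real_normed_vector \<Rightarrow> 'e::euclidean_space \<Rightarrow> 'e \<Rightarrow> real"
  assumes B: "\<And>u v. lipschitz_near (\<lambda>y. B y u v) x" and k: "\<And>v. lipschitz_near (\<lambda>y. k y v) x"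
    and bil: "\<forall>\<^sub>F y in nhds x. bilinear (B y)"
    and sol: "\<forall>\<^sub>F y in nhds x. \<forall>v. B y (G y) v = k y v"
    and nd: "\<And>u. (\<forall>v. B x u v = 0) \<Longrightarrow> u = 0"
  shows "lipschitz_near G x"
proof -
  \<comment> \<open>Elementary operators: with them \<open>A\<close> is a finite sum of fixed
    operators with scalar Lipschitz coefficients, so it is Lipschitz in operator norm.\<close>
  define E where "E i j = Blinfun (\<lambda>w. (w \<bullet> i) *\<^sub>R j)" for i j :: 'e
  have E: "E i j w = (w \<bullet> i) *\<^sub>R j" for i j w
    unfolding E_def
    by (subst bounded_linear_Blinfun_apply)
      (auto intro: bounded_linear_scaleR_const bounded_linear_inner_left)
  define A where "A y = (\<Sum>i\<in>Basis. \<Sum>j\<in>Basis. B y i j *\<^sub>R E i j)" for y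
  have A: "A y w = (\<Sum>j\<in>Basis. B y w j *\<^sub>R j)" if "bilinear (B y)" for y w
  proof -
    have lin: "linear (\<lambda>w. B y w j)" for j using that by (simp add: bilinear_def)
    have "A y w = (\<Sum>j\<in>Basis. (\<Sum>i\<in>Basis. (w \<bullet> i) *\<^sub>R B y i j) *\<^sub>R j)"
      unfolding A_def
      by (subst sum.swap) (simp add: blinfun.sum_left blinfun.scaleR_left E scaleR_sum_left mult.commute)
    then show ?thesis by (simp only: linear_euclidean_representation[OF lin])
  qed
  have bx: "bilinear (B x)" using bil by (rule eventually_nhds_x_imp_x)
  have "w = 0" if "A x w = 0" for w
  proof -
    have "B x w j = 0" if "j \<in> Basis" for j
    proof -
      have "A x w \<bullet> j = B x w j" using A[OF bx, of w] that by simp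
      then show ?thesis using \<open>A x w = 0\<close> by simp
    qed
    moreover have "linear (B x w)" using bx by (simp add: bilinear_def)
    ultimately have "B x w v = 0" for v
      using linear_euclidean_representation[of "B x w" v] by simp
    then show ?thesis using nd by blast
  qed
  moreover have lin: "linear (blinfun_apply (A x))"
    by (rule bounded_linear.linear[OF blinfun.bounded_linear_right])
  ultimately have "inj (blinfun_apply (A x))"
    using linear_injective_0 by blast
  with lin obtain c where c: "c > 0" "\<And>w. c * norm w \<le> norm (A x w)"
    using linear_inj_bounded_below_pos by blast
  show ?thesis
  proof (rule lipschitz_near_linear_solution[where A = A and x = x, OF _ _ _ c])
    show "lipschitz_near A x"
      unfolding A_def
      by (intro lipschitz_near_sum lipschitz_near_bounded_bilinear[OF bounded_bilinear_scaleR]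
          lipschitz_near_const B finite_Basis)
    show "lipschitz_near (\<lambda>y. \<Sum>j\<in>Basis. k y j *\<^sub>R j) x"
      by (intro lipschitz_near_sum lipschitz_near_bounded_bilinear[OF bounded_bilinear_scaleR]
          lipschitz_near_const k finite_Basis)
    show "\<forall>\<^sub>F y in nhds x. A y (G y) = (\<Sum>j\<in>Basis. k y j *\<^sub>R j)"
      using bil sol by eventually_elim (simp add: A)
  qed
qed

subsection \<open>Pseudo-Riemannian manifolds\<close>

locale pseudo_riemannian_manifold =
  fixes A :: "('m::{t2_space,second_countable_topology}, 'e::euclidean_space) chart set"
    and g :: "('m, 'e) chart \<Rightarrow> 'e \<Rightarrow> 'e \<Rightarrow> 'e \<Rightarrow> real"
  assumes atlas: "smooth_atlas A" and metric: "pseudo_riemannian_metric A g"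
begin

section \<open>Charts and coordinate changes\<close>

lemma chart: "c \<in> A \<Longrightarrow> is_chart c"
  using atlas by (simp add: smooth_atlas_def)

lemma open_chdom: "c \<in> A \<Longrightarrow> open (chdom c)"
  and open_chimg: "c \<in> A \<Longrightarrow> open (chimg c)"
  and chart_homeomorphism: "c \<in> A \<Longrightarrow> homeomorphism (chdom c) (chimg c) (chmap c) (chinv c)"
  using chart by (auto simp: is_chart_def)

lemma chart_at: obtains c where "c \<in> A" "p \<in> chdom c"
  using atlas unfolding smooth_atlas_def by (metis UN_E UNIV_I)

lemma chmap_in: "p \<in> chdom c \<Longrightarrow> chmap c p \<in> chimg c"
  by (simp add: chimg_def)

lemma chinv_in: "c \<in> A \<Longrightarrow> x \<in> chimg c \<Longrightarrow> chinv c x \<in> chdom c"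
  and chinv_chmap: "c \<in> A \<Longrightarrow> p \<in> chdom c \<Longrightarrow> chinv c (chmap c p) = p"
  and chmap_chinv: "c \<in> A \<Longrightarrow> x \<in> chimg c \<Longrightarrow> chmap c (chinv c x) = x"
  using chart_homeomorphism[of c] unfolding homeomorphism_def by blast+

lemma continuous_on_chinv: "c \<in> A \<Longrightarrow> continuous_on (chimg c) (chinv c)"
  using chart_homeomorphism[of c] by (simp add: homeomorphism_def)

definition overlap :: "('m, 'e) chart \<Rightarrow> ('m, 'e) chart \<Rightarrow> 'e set" where
  "overlap c d = chmap c ` (chdom c \<inter> chdom d)"

lemma overlapI: "p \<in> chdom c \<Longrightarrow> p \<in> chdom d \<Longrightarrow> chmap c p \<in> overlap c d"
  by (simp add: overlap_def)

lemma open_overlap: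
  assumes c: "c \<in> A" and d: "d \<in> A"
  shows "open (overlap c d)"
proof -
  have "overlap c d = chimg c \<inter> chinv c -` chdom d"
    using chinv_chmap[OF c] chinv_in[OF c] chmap_chinv[OF c]
    by (force simp: overlap_def chimg_def)
  then show ?thesis
    using continuous_open_preimage[OF continuous_on_chinv[OF c] open_chimg[OF c] open_chdom[OF d]]
    by simp
qed

lemma transition_chmap:
  "c \<in> A \<Longrightarrow> p \<in> chdom c \<Longrightarrow> transition c d (chmap c p) = chmap d p"
  by (simp add: transition_def chinv_chmap)

lemma smooth_transition: "c \<in> A \<Longrightarrow> d \<in> A \<Longrightarrow> smooth_on (overlap c d) (transition c d)"
  using atlas by (simp add: smooth_atlas_def overlap_def)

lemma transition_has_derivative:
  assumes "c \<in> A" "d \<in> A" "p \<in> chdom c" "p \<in> chdom d"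
  shows "(transition c d has_derivative jac c d p) (at (chmap c p))"
  using smooth_on_has_derivative[OF smooth_transition overlapI] assms
  unfolding jac_def by blast

lemma linear_jac:
  assumes "c \<in> A" "d \<in> A" "p \<in> chdom c" "p \<in> chdom d"
  shows "linear (jac c d p)"
  using transition_has_derivative[OF assms] has_derivative_linear by blast

lemma jac_inverse:
  assumes c: "c \<in> A" "p \<in> chdom c" and d: "d \<in> A" "p \<in> chdom d"
  shows "jac d c p (jac c d p u) = u"
proof -
  have "((\<lambda>x. transition d c (transition c d x)) has_derivative (\<lambda>u. jac d c p (jac c d p u))) (at (chmap c p))"
    using has_derivative_compose[OF transition_has_derivative[OF c(1) d(1) c(2) d(2)]]
      transition_has_derivative[OF d(1) c(1) d(2) c(2)]
    by (simp add: transition_chmap[OF c])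
  moreover have "transition d c (transition c d x) = x" if "x \<in> overlap c d" for x
    using that c d by (auto simp: overlap_def transition_chmap)
  ultimately have "((\<lambda>x. x) has_derivative (\<lambda>u. jac d c p (jac c d p u))) (at (chmap c p))"
    using has_derivative_transform_within_open open_overlap[OF c(1) d(1)] overlapI[OF c(2) d(2)] by metis
  then show ?thesis
    using has_derivative_unique[OF has_derivative_ident] by metis
qed

section \<open>The metric and its Levi-Civita coefficients\<close>

lemma smooth_metric: "c \<in> A \<Longrightarrow> smooth_on (chimg c) (\<lambda>x. g c x u v)"
  using metric by (simp add: pseudo_riemannian_metric_def)

lemma bilinear_metric: "c \<in> A \<Longrightarrow> x \<in> chimg c \<Longrightarrow> bilinear (g c x)"
  and metric_sym: "c \<in> A \<Longrightarrow> x \<in> chimg c \<Longrightarrow> g c x u v = g c x v u"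
  and metric_nondegenerate: "c \<in> A \<Longrightarrow> x \<in> chimg c \<Longrightarrow> (\<forall>v. g c x u v = 0) \<Longrightarrow> u = 0"
  using metric unfolding pseudo_riemannian_metric_def by blast+

lemma metric_jac:
  assumes "c \<in> A" "p \<in> chdom c" and "d \<in> A" "p \<in> chdom d"
  shows "g d (chmap d p) (jac c d p u) (jac c d p v) = g c (chmap c p) u v"
  using metric assms unfolding pseudo_riemannian_metric_def by blast

lemma eventually_chimg: "c \<in> A \<Longrightarrow> x \<in> chimg c \<Longrightarrow> \<forall>\<^sub>F y in nhds x. y \<in> chimg c"
  using open_chimg eventually_nhds_in_open by blast

lemma eventually_bilinear_metric: "c \<in> A \<Longrightarrow> x \<in> chimg c \<Longrightarrow> \<forall>\<^sub>F y in nhds x. bilinear (g c y)"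
  using eventually_chimg bilinear_metric by (metis (mono_tags, lifting) eventually_mono)

lemma metric_has_derivative:
  "c \<in> A \<Longrightarrow> x \<in> chimg c \<Longrightarrow> ((\<lambda>y. g c y u v) has_derivative dder (\<lambda>y. g c y u v) x) (at x)"
  by (rule smooth_on_has_derivative[OF smooth_metric])

lemma levi_civita_at_ex1:
  assumes c: "c \<in> A" "x \<in> chimg c"
  shows "\<exists>!\<Gamma>. levi_civita_at (g c) x \<Gamma>"
  by (rule levi_civita_at_unique_existence[OF open_chimg[OF c(1)] c(2)])
    (use metric_has_derivative[OF c] bilinear_metric[OF c(1)] metric_sym[OF c(1)] metric_nondegenerate[OF c]
      in \<open>auto simp: differentiable_def\<close>)

lemma levi_civita_at:
  assumes "c \<in> A" "x \<in> chimg c"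
  shows "levi_civita_at (g c) x (levi_civita g c x)"
  unfolding levi_civita_def by (rule theI'[OF levi_civita_at_ex1[OF assms]])

lemma levi_civita_eqI:
  assumes "c \<in> A" "x \<in> chimg c" "levi_civita_at (g c) x \<Gamma>"
  shows "levi_civita g c x = \<Gamma>"
  using levi_civita_at_ex1[OF assms(1,2)] levi_civita_at[OF assms(1,2)] assms(3) by blast

lemma bilinear_levi_civita: "c \<in> A \<Longrightarrow> x \<in> chimg c \<Longrightarrow> bilinear (levi_civita g c x)"
  and levi_civita_sym: "c \<in> A \<Longrightarrow> x \<in> chimg c \<Longrightarrow> levi_civita g c x u v = levi_civita g c x v u"
  using levi_civita_at[of c x] unfolding levi_civita_at_def by blast+

lemma metric_derivative: "c \<in> A \<Longrightarrow> x \<in> chimg c \<Longrightarrow>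
    dder (\<lambda>y. g c y u v) x w = g c x (levi_civita g c x w u) v + g c x u (levi_civita g c x w v)"
  using levi_civita_at[of c x] by (simp add: levi_civita_at_def cov02_def diff_diff_eq)

text \<open>The coefficients of chart \<open>d\<close>, pulled back to \<open>c\<close> with the
  second derivative of the coordinate change added, are symmetric and metric, so uniqueness
  identifies them with those of \<open>c\<close>. Symmetry is where mixed second derivatives have to
  commute.\<close>

lemma levi_civita_jac:
  assumes c: "c \<in> A" "p \<in> chdom c" and d: "d \<in> A" "p \<in> chdom d"
  shows "levi_civita g d (chmap d p) (jac c d p u) (jac c d p v) =
    jac c d p (levi_civita g c (chmap c p) u v)
    - dder (\<lambda>x. dder (transition c d) x v) (chmap c p) u"
proof -
  define x y \<Phi> where "x = chmap c p" and "y = chmap d p" and "\<Phi> = transition c d"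
  define P P' where "P = jac c d p" and "P' = jac d c p"
  define Q where "Q w u = dder (\<lambda>z. dder \<Phi> z u) x w" for w u
  define \<Gamma> where "\<Gamma> = levi_civita g d y"
  define \<Gamma>' where "\<Gamma>' w u = P' (\<Gamma> (P w) (P u) + Q w u)" for w u
  have x: "x \<in> chimg c" "x \<in> overlap c d" and y: "y \<in> chimg d"
    using c d by (simp_all add: x_def y_def chmap_in overlapI)
  have \<Phi>x: "\<Phi> x = y" using c by (simp add: x_def y_def \<Phi>_def transition_chmap)
  have \<Phi>: "smooth_on (overlap c d) \<Phi>" and op: "open (overlap c d)"
    using c d by (simp_all add: \<Phi>_def smooth_transition open_overlap)
  have P: "linear P" and P': "linear P'" using c d by (simp_all add: P_def P'_def linear_jac)
  have PP': "P (P' u) = u" for u using jac_inverse[OF d c] by (simp add: P_def P'_def)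
  have \<Gamma>: "bilinear \<Gamma>" and \<Gamma>_sym: "\<Gamma> u v = \<Gamma> v u" for u v
    unfolding \<Gamma>_def by (rule bilinear_levi_civita[OF d(1) y], rule levi_civita_sym[OF d(1) y])
  have \<Phi>': "((\<lambda>z. dder \<Phi> z u) has_derivative (\<lambda>w. Q w u)) (at x)" for u
    unfolding Q_def by (rule smooth_on_has_derivative[OF smooth_on_dder[OF \<Phi>] x(2)])
  have Q_sym: "Q w u = Q u w" for w u
    unfolding Q_def by (rule smooth_on_second_derivative_symmetric[OF \<Phi> op x(2)])
  have Q: "linear (\<lambda>w. Q w u)" for u using \<Phi>' has_derivative_linear by blast
  have lin: "linear (\<lambda>w. \<Gamma>' w u)" for u
    unfolding \<Gamma>'_def
    by (rule linearI)
      (simp_all add: linear_add[OF P] linear_scale[OF P] linear_add[OF P'] linear_scale[OF P']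
        linear_add[OF Q] linear_scale[OF Q] bilinear_ladd[OF \<Gamma>] bilinear_lmul[OF \<Gamma>] algebra_simps)
  have \<Gamma>'_sym: "\<Gamma>' w u = \<Gamma>' u w" for w u
    by (simp add: \<Gamma>'_def Q_sym[of w] \<Gamma>_sym[of "P w"])
  then have lin2: "linear (\<Gamma>' u)" for u using lin[of u] by presburger
  have jac: "dder \<Phi> x u = P u" for u by (simp add: P_def \<Phi>_def x_def jac_def)
  have "cov02 (\<lambda>_. \<Gamma>') (g c) x w u v = 0" for w u v
  proof -
    have "(\<Phi> has_derivative P) (at x)"
      using transition_has_derivative[OF c(1) d(1) c(2) d(2)] by (simp add: P_def \<Phi>_def x_def)
    note comp = has_derivative_compose[OF this]
    have gd: "((\<lambda>z. g d (\<Phi> z) u v) has_derivative (\<lambda>w. dder (\<lambda>y. g d y u v) y (P w))) (at x)" for u v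
      using comp[of "\<lambda>y. g d y u v"] metric_has_derivative[OF d(1) y] by (simp add: \<Phi>x)
    have ev: "\<forall>\<^sub>F z in nhds x. bilinear (g d (\<Phi> z))"
      using eventually_nhds_in_open[OF op x(2)]
    proof eventually_elim
      case (elim z)
      then show ?case
        using c d by (auto simp: overlap_def \<Phi>_def transition_chmap intro!: bilinear_metric chmap_in)
    qed
    \<comment> \<open>Metric compatibility comes from differentiating the invariance
      \<open>metric_jac\<close>; \<open>Q\<close> arises because the transported vectors
      \<open>dder \<Phi> z u\<close> vary with \<open>z\<close>.\<close>
    have "((\<lambda>z. g d (\<Phi> z) (dder \<Phi> z u) (dder \<Phi> z v)) has_derivative
        (\<lambda>w. dder (\<lambda>y. g d y (P u) (P v)) y (P w) + g d y (Q w u) (P v) + g d y (P u) (Q w v))) (at x)"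
      using has_derivative_bilinear_family[OF ev gd \<Phi>' \<Phi>', of u v] by (simp add: \<Phi>x jac)
    moreover have "g d (\<Phi> z) (dder \<Phi> z u) (dder \<Phi> z v) = g c z u v" if z: "z \<in> overlap c d" for z
    proof -
      obtain q where q: "q \<in> chdom c" "q \<in> chdom d" "z = chmap c q"
        using z by (auto simp: overlap_def)
      show ?thesis
        using metric_jac[OF c(1) q(1) d(1) q(2), of u v] c(1) q by (simp add: jac_def \<Phi>_def transition_chmap)
    qed
    ultimately have "((\<lambda>z. g c z u v) has_derivative
        (\<lambda>w. dder (\<lambda>y. g d y (P u) (P v)) y (P w) + g d y (Q w u) (P v) + g d y (P u) (Q w v))) (at x)"
      by (rule has_derivative_transform_within_open[OF _ op x(2)])
    from fun_cong[OF has_derivative_unique[OF metric_has_derivative[OF c(1) x(1)] this], of w]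
    have "dder (\<lambda>z. g c z u v) x w =
        dder (\<lambda>y. g d y (P u) (P v)) y (P w) + g d y (Q w u) (P v) + g d y (P u) (Q w v)" .
    also have "\<dots> = g d y (P (\<Gamma>' w u)) (P v) + g d y (P u) (P (\<Gamma>' w v))"
      using bilinear_metric[OF d(1) y]
      by (simp add: \<Gamma>'_def PP' metric_derivative[OF d(1) y] \<Gamma>_def bilinear_ladd bilinear_radd)
    also have "\<dots> = g c x (\<Gamma>' w u) v + g c x u (\<Gamma>' w v)"
      using metric_jac[OF c d] by (simp add: P_def x_def y_def)
    finally show ?thesis by (simp add: cov02_def)
  qed
  then have "levi_civita_at (g c) x \<Gamma>'"
    using lin lin2 \<Gamma>'_sym by (simp add: levi_civita_at_def bilinear_def)
  then have "levi_civita g c x u v = \<Gamma>' u v"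
    using levi_civita_eqI[OF c(1) x(1)] by simp
  then show ?thesis
    by (simp add: \<Gamma>'_def PP' P_def[symmetric] x_def[symmetric] y_def[symmetric] \<Gamma>_def[symmetric]
        \<Phi>_def[symmetric] Q_def[symmetric])
qed

text \<open>The function \<open>k\<close> is the right side of the Koszul formula in coordinates,
  which determines the coefficients through the nondegenerate metric. Its derivatives of
  \<open>g\<close> are smooth, hence locally Lipschitz.\<close>

lemma lipschitz_near_levi_civita:
  assumes c: "c \<in> A" "x \<in> chimg c"
  shows "lipschitz_near (\<lambda>y. levi_civita g c y u v) x"
proof (rule lipschitz_near_representation[where B = "g c" and k = "\<lambda>y z.
    (dder (\<lambda>y. g c y v z) y u + dder (\<lambda>y. g c y u z) y v + - 1 * dder (\<lambda>y. g c y u v) y z) * (1/2)"])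
  have sm: "lipschitz_near f x" if "smooth_on (chimg c) f" for f :: "'e \<Rightarrow> real"
    unfolding lipschitz_near_def by (rule smooth_on_imp_lipschitz_on[OF that open_chimg[OF c(1)] c(2)])
  show "lipschitz_near (\<lambda>y. g c y u v) x" for u v
    by (rule sm[OF smooth_metric[OF c(1)]])
  show "lipschitz_near (\<lambda>y. (dder (\<lambda>y. g c y v z) y u + dder (\<lambda>y. g c y u z) y v
      + - 1 * dder (\<lambda>y. g c y u v) y z) * (1/2)) x" for z
    by (intro lipschitz_near_bounded_bilinear[OF bounded_bilinear_mult] lipschitz_near_add
        lipschitz_near_const sm smooth_on_dder smooth_metric c)
  show "\<forall>\<^sub>F y in nhds x. bilinear (g c y)"
    by (rule eventually_bilinear_metric[OF c])
  show "u = 0" if "\<forall>v. g c x u v = 0" for u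
    using metric_nondegenerate[OF c that] .
  show "\<forall>\<^sub>F y in nhds x. \<forall>z. g c y (levi_civita g c y u v) z =
      (dder (\<lambda>y. g c y v z) y u + dder (\<lambda>y. g c y u z) y v + - 1 * dder (\<lambda>y. g c y u v) y z) * (1/2)"
    using eventually_chimg[OF c]
  proof eventually_elim
    case (elim y)
    note s = metric_sym[OF c(1) elim] and l = levi_civita_sym[OF c(1) elim]
    show ?case
    proof
      fix z
      show "g c y (levi_civita g c y u v) z = (dder (\<lambda>y. g c y v z) y u
          + dder (\<lambda>y. g c y u z) y v + - 1 * dder (\<lambda>y. g c y u v) y z) * (1/2)"
        by (simp add: metric_derivative[OF c(1) elim] l[of v u] l[of z u] l[of z v]
            s[of v "levi_civita g c y u z"] s[of u "levi_civita g c y v z"])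
    qed
  qed
qed

section \<open>The geodesic equation as a first-order system, and its local solutions\<close>

definition spray :: "('m, 'e) chart \<Rightarrow> 'e \<times> 'e \<Rightarrow> 'e \<times> 'e" where
  "spray c z = (snd z, - levi_civita g c (fst z) (snd z) (snd z))"

text \<open>The coefficients are known to be Lipschitz only for fixed arguments. Expanding both
  velocity slots in the basis makes the dependence on the velocity polynomial; the expansion holds
  only over the chart, hence the passage through \<open>lipschitz_near_cong\<close>.\<close>

lemma lipschitz_near_spray:
  assumes c: "c \<in> A" "x \<in> chimg c"
  shows "lipschitz_near (spray c) (x, v)"
proof (rule lipschitz_near_cong)
  show "lipschitz_near (\<lambda>z. (snd z, \<Sum>i\<in>Basis. \<Sum>j\<in>Basis.
      ((snd z \<bullet> i) * (snd z \<bullet> j)) *\<^sub>R (- 1) *\<^sub>R levi_civita g c (fst z) i j)) (x, v)"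
  proof -
    have v: "lipschitz_near (\<lambda>z. snd z \<bullet> i) (x, v)" for i :: 'e
      by (intro lipschitz_near_bounded_linear bounded_linear_inner_left_comp bounded_linear_snd)
    have "lipschitz_near (\<lambda>z. levi_civita g c (fst z) i j) (x, v)" for i j
      by (rule lipschitz_near_compose[where g = fst])
        (simp_all add: lipschitz_near_levi_civita[OF c] lipschitz_near_bounded_linear bounded_linear_fst)
    note * = lipschitz_near_bounded_bilinear[OF bounded_bilinear_scaleR _
        lipschitz_near_bounded_bilinear[OF bounded_bilinear_scaleR lipschitz_near_const this]]
      lipschitz_near_bounded_bilinear[OF bounded_bilinear_mult v v]
    show ?thesis
      by (intro lipschitz_near_Pair lipschitz_near_bounded_linear[OF bounded_linear_snd]
          lipschitz_near_sum finite_Basis *)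
  qed
  have "open (chimg c \<times> (UNIV :: 'e set))" using open_chimg[OF c(1)] by (intro open_Times) auto
  then have "\<forall>\<^sub>F z in nhds (x, v). z \<in> chimg c \<times> UNIV"
    using c by (intro eventually_nhds_in_open) auto
  then show "\<forall>\<^sub>F z in nhds (x, v). (snd z, \<Sum>i\<in>Basis. \<Sum>j\<in>Basis.
      ((snd z \<bullet> i) * (snd z \<bullet> j)) *\<^sub>R (- 1) *\<^sub>R levi_civita g c (fst z) i j) = spray c z"
  proof eventually_elim
    case (elim z)
    obtain y w where z: "z = (y, w)" by (cases z)
    have bil: "bilinear (levi_civita g c y)" using elim z bilinear_levi_civita[OF c(1)] by auto
    then have l: "linear (levi_civita g c y w)" "linear (\<lambda>w. levi_civita g c y w j)" for j
      by (simp_all add: bilinear_def)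
    have "(\<Sum>i\<in>Basis. \<Sum>j\<in>Basis. ((w \<bullet> i) * (w \<bullet> j)) *\<^sub>R (- 1) *\<^sub>R levi_civita g c y i j)
      = - (\<Sum>j\<in>Basis. (w \<bullet> j) *\<^sub>R (\<Sum>i\<in>Basis. (w \<bullet> i) *\<^sub>R levi_civita g c y i j))"
      by (subst sum.swap) (simp add: sum_negf scaleR_sum_right mult.commute)
    also have "\<dots> = - levi_civita g c y w w"
      by (simp only: linear_euclidean_representation[OF l(2)] linear_euclidean_representation[OF l(1)])
    finally show ?case by (simp add: z spray_def)
  qed
qed

lemma local_geodesic:
  assumes c: "c \<in> A" "x0 \<in> chimg c"
  shows "\<exists>I \<gamma>. geodesic_on A g I \<gamma> \<and> 0 \<in> I \<and> \<gamma> 0 = chinv c x0 \<and>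
    ((\<lambda>t. chmap c (\<gamma> t)) has_vector_derivative v0) (at 0)"
proof -
  obtain r0 L where r0: "r0 > 0" "L-lipschitz_on (ball (x0, v0) r0) (spray c)"
    using lipschitz_near_spray[OF c] unfolding lipschitz_near_def by blast
  obtain r1 where r1: "r1 > 0" "cball x0 r1 \<subseteq> chimg c"
    using open_chimg[OF c(1)] c(2) open_contains_cball by blast
  \<comment> \<open>Halving \<open>r0\<close> puts a closed ball inside the open one where the spray
    is Lipschitz; \<open>r1\<close> keeps positions inside the chart image.\<close>
  define r where "r = min (r0 / 2) r1"
  have r: "r > 0" using r0 r1 by (simp add: r_def)
  have "L-lipschitz_on (cball (x0, v0) r) (spray c)"
    by (rule lipschitz_on_subset[OF r0(2)]) (use r0(1) in \<open>auto simp: r_def\<close>)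
  then obtain \<delta> z where \<delta>: "\<delta> > 0" and z0: "z 0 = (x0, v0)"
    and zr: "\<And>t. t \<in> {-\<delta><..<\<delta>} \<Longrightarrow> z t \<in> cball (x0, v0) r"
    and z: "\<And>t. t \<in> {-\<delta><..<\<delta>} \<Longrightarrow> (z has_vector_derivative spray c (z t)) (at t)"
    using picard_lindelof_local[OF r] by metis
  define I where "I = {-\<delta><..<\<delta>}"
  define x v where "x t = fst (z t)" and "v t = snd (z t)" for t
  define \<gamma> where "\<gamma> t = chinv c (x t)" for t
  have x: "(x has_vector_derivative v t) (at t)"
    and v: "(v has_vector_derivative - levi_civita g c (x t) (v t) (v t)) (at t)" if "t \<in> I" for t
    using bounded_linear.has_vector_derivative[OF bounded_linear_fst z[OF that[unfolded I_def]]]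
      bounded_linear.has_vector_derivative[OF bounded_linear_snd z[OF that[unfolded I_def]]]
    by (simp_all add: x_def[abs_def] v_def[abs_def] spray_def)
  have xc: "x t \<in> chimg c" if "t \<in> I" for t
  proof -
    have "dist x0 (x t) \<le> dist (x0, v0) (z t)"
      using dist_fst_le[of "(x0, v0)" "z t"] by (simp add: x_def)
    also have "\<dots> \<le> r1" using zr that by (auto simp: I_def r_def)
    finally show ?thesis using r1(2) by auto
  qed
  have \<gamma>c: "\<gamma> t \<in> chdom c" "chmap c (\<gamma> t) = x t" if "t \<in> I" for t
    using xc[OF that] c by (simp_all add: \<gamma>_def chinv_in chmap_chinv)
  have opI: "open I" by (simp add: I_def)
  have contx: "continuous_on I x"
    using x by (meson continuous_at_imp_continuous_on has_vector_derivative_continuous)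
  have cont: "continuous_on I \<gamma>"
    unfolding \<gamma>_def using continuous_on_compose2[OF continuous_on_chinv[OF c(1)] contx] xc by blast
  have geo: "\<exists>w. (\<forall>\<^sub>F s in nhds t. ((\<lambda>r. chmap d (\<gamma> r)) has_vector_derivative w s) (at s)) \<and>
      (w has_vector_derivative - levi_civita g d (chmap d (\<gamma> t)) (w t) (w t)) (at t)"
    if d: "d \<in> A" and t: "t \<in> I" and td: "\<gamma> t \<in> chdom d" for d t
  proof (intro exI conjI)
    let ?\<Phi> = "transition c d"
    \<comment> \<open>The velocity in another chart \<open>d\<close>, namely the image of
      \<open>v\<close> under the differential of the coordinate change.\<close>
    define w where "w s = dder ?\<Phi> (x s) (v s)" for s
    have op: "open (I \<inter> \<gamma> -` chdom d)"
      by (rule continuous_open_preimage[OF cont opI open_chdom[OF d]])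
    have ov: "x s \<in> overlap c d" if "s \<in> I" "\<gamma> s \<in> chdom d" for s
      using \<gamma>c[OF that(1)] overlapI[of "\<gamma> s" c d] that by simp
    have vel: "((\<lambda>r. chmap d (\<gamma> r)) has_vector_derivative w s) (at s)"
      if s: "s \<in> I \<inter> \<gamma> -` chdom d" for s
    proof -
      have "((\<lambda>r. ?\<Phi> (x r)) has_derivative (\<lambda>h. dder ?\<Phi> (x s) (h *\<^sub>R v s))) (at s)"
        using has_derivative_compose[OF x[unfolded has_vector_derivative_def]
            smooth_on_has_derivative[OF smooth_transition[OF c(1) d] ov]] s by simp
      moreover have "linear (dder ?\<Phi> (x s))"
        using smooth_on_has_derivative[OF smooth_transition[OF c(1) d] ov] s has_derivative_linear by blast
      ultimately have "((\<lambda>r. ?\<Phi> (x r)) has_vector_derivative w s) (at s)"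
        by (simp add: has_vector_derivative_def w_def linear_scale)
      moreover have "?\<Phi> (x r) = chmap d (\<gamma> r)" if "r \<in> I \<inter> \<gamma> -` chdom d" for r
        using that \<gamma>c[of r] transition_chmap[OF c(1), of "\<gamma> r" d] by simp
      ultimately show ?thesis
        by (rule has_vector_derivative_transform_within_open[OF _ op s])
    qed
    show "\<forall>\<^sub>F s in nhds t. ((\<lambda>r. chmap d (\<gamma> r)) has_vector_derivative w s) (at s)"
    proof (rule eventually_mono)
      show "\<forall>\<^sub>F s in nhds t. s \<in> I \<inter> \<gamma> -` chdom d"
        using eventually_nhds_in_open[OF op] t td by simp
    qed (rule vel)
    have xt: "x t \<in> overlap c d" using ov t td .
    have lin: "\<forall>\<^sub>F s in nhds t. linear (dder ?\<Phi> (x s))"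
    proof -
      have "\<forall>\<^sub>F s in nhds t. s \<in> I \<inter> \<gamma> -` chdom d"
        using eventually_nhds_in_open[OF op] t td by simp
      then show ?thesis
      proof eventually_elim
        case (elim s)
        then show ?case
          using smooth_on_has_derivative[OF smooth_transition[OF c(1) d] ov] has_derivative_linear by blast
      qed
    qed
    have D: "((\<lambda>s. dder ?\<Phi> (x s) u) has_derivative
        (\<lambda>h. dder (\<lambda>y. dder ?\<Phi> y u) (x t) (h *\<^sub>R v t))) (at t)" for u
      using has_derivative_compose[OF x[OF t, unfolded has_vector_derivative_def]
          smooth_on_has_derivative[OF smooth_on_dder[OF smooth_transition[OF c(1) d]] xt]] .
    have lin2: "linear (dder (\<lambda>y. dder ?\<Phi> y u) (x t))" for u
      using smooth_on_has_derivative[OF smooth_on_dder[OF smooth_transition[OF c(1) d]] xt]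
        has_derivative_linear by blast
    have lint: "linear (dder ?\<Phi> (x t))" using lin by (rule eventually_nhds_x_imp_x)
    let ?a = "- levi_civita g c (x t) (v t) (v t)"
    have "(w has_vector_derivative
        (dder (\<lambda>y. dder ?\<Phi> y (v t)) (x t) (v t) + dder ?\<Phi> (x t) ?a)) (at t)"
      unfolding has_vector_derivative_def w_def
      using has_derivative_linear_family[OF lin D v[OF t, unfolded has_vector_derivative_def]]
      by (simp only: linear_scale[OF lin2] linear_scale[OF lint] scaleR_add_right)
    \<comment> \<open>The inhomogeneous term of the transformation law matches the second derivative
      that appears when \<open>w\<close> is differentiated, so the geodesic equation holds in
      \<open>d\<close> as well.\<close>
    moreover have "levi_civita g d (chmap d (\<gamma> t)) (w t) (w t) =
        dder ?\<Phi> (x t) (levi_civita g c (x t) (v t) (v t)) - dder (\<lambda>y. dder ?\<Phi> y (v t)) (x t) (v t)"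
      using levi_civita_jac[OF c(1) \<gamma>c(1)[OF t] d td, of "v t" "v t"] t
      by (simp add: jac_def \<gamma>c w_def)
    ultimately show "(w has_vector_derivative - levi_civita g d (chmap d (\<gamma> t)) (w t) (w t)) (at t)"
      by (simp add: linear_neg[OF lint])
  qed
  have 0: "0 \<in> I" using \<delta> by (simp add: I_def)
  have "geodesic_on A g I \<gamma>"
    unfolding geodesic_on_def using opI cont geo 0 by (auto simp: I_def is_interval_oo)
  moreover have "((\<lambda>t. chmap c (\<gamma> t)) has_vector_derivative v0) (at 0)"
    using has_vector_derivative_transform_within_open[OF x[OF 0] opI 0, of "\<lambda>t. chmap c (\<gamma> t)"] \<gamma>c z0
    by (simp add: v_def)
  moreover have "\<gamma> 0 = chinv c x0" by (simp add: \<gamma>_def x_def z0)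
  ultimately show ?thesis using 0 by blast
qed

end

subsection \<open>Pairing a vector field with the velocity of a geodesic\<close>

context pseudo_riemannian_manifold
begin

definition velocity :: "(real \<Rightarrow> 'm) \<Rightarrow> ('m, 'e) chart \<Rightarrow> real \<Rightarrow> 'e" where
  "velocity \<gamma> c t = vector_derivative (\<lambda>s. chmap c (\<gamma> s)) (at t)"

text \<open>The value does not depend on the chosen chart when \<open>X\<close> transforms as a vector field.\<close>

definition velocity_pairing :: "(real \<Rightarrow> 'm) \<Rightarrow> (('m, 'e) chart \<Rightarrow> 'e \<Rightarrow> 'e) \<Rightarrow> real \<Rightarrow> real" where
  "velocity_pairing \<gamma> X t = (let c = SOME c. c \<in> A \<and> \<gamma> t \<in> chdom c in
    g c (chmap c (\<gamma> t)) (velocity \<gamma> c t) (X c (chmap c (\<gamma> t))))"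

context
  fixes \<gamma> :: "real \<Rightarrow> 'm"
  assumes geodesic: "geodesic_on A g UNIV \<gamma>"
begin

lemma eventually_chdom:
  assumes "c \<in> A" "\<gamma> t \<in> chdom c"
  shows "\<forall>\<^sub>F s in nhds t. \<gamma> s \<in> chdom c"
proof -
  have "continuous_on UNIV \<gamma>" using geodesic by (simp add: geodesic_on_def)
  then have "open (\<gamma> -` chdom c)"
    using continuous_on_open_vimage[OF open_UNIV, of \<gamma>] open_chdom[OF assms(1)] by simp
  then show ?thesis using eventually_nhds_in_open[of "\<gamma> -` chdom c" t] assms(2) by simp
qed

text \<open>The witness in \<open>geodesic_on\<close> may change with \<open>t\<close> and is a
  velocity only near \<open>t\<close>. Derivatives are unique, so the single function
  \<open>velocity \<gamma> c\<close> can replace all witnesses in the chart.\<close>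

lemma velocity:
  assumes "c \<in> A" "\<gamma> t \<in> chdom c"
  shows "((\<lambda>s. chmap c (\<gamma> s)) has_vector_derivative velocity \<gamma> c t) (at t)"
    and "(velocity \<gamma> c has_vector_derivative
      - levi_civita g c (chmap c (\<gamma> t)) (velocity \<gamma> c t) (velocity \<gamma> c t)) (at t)"
proof -
  obtain v where v: "\<forall>\<^sub>F s in nhds t. ((\<lambda>r. chmap c (\<gamma> r)) has_vector_derivative v s) (at s)"
    and v': "(v has_vector_derivative - levi_civita g c (chmap c (\<gamma> t)) (v t) (v t)) (at t)"
    using geodesic assms unfolding geodesic_on_def by blast
  have eq: "\<forall>\<^sub>F s in nhds t. v s = velocity \<gamma> c s"
    using v by eventually_elim (simp add: velocity_def vector_derivative_at)
  then have eqt: "v t = velocity \<gamma> c t" by (rule eventually_nhds_x_imp_x)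
  show "((\<lambda>s. chmap c (\<gamma> s)) has_vector_derivative velocity \<gamma> c t) (at t)"
    using eventually_nhds_x_imp_x[OF v] by (simp add: eqt)
  have ev: "\<forall>\<^sub>F s in at t. v s = velocity \<gamma> c s"
    using eq by (auto simp: eventually_at_filter elim: eventually_mono)
  show "(velocity \<gamma> c has_vector_derivative
      - levi_civita g c (chmap c (\<gamma> t)) (velocity \<gamma> c t) (velocity \<gamma> c t)) (at t)"
    unfolding has_vector_derivative_def
    by (rule has_derivative_transform_eventually[OF v'[unfolded has_vector_derivative_def eqt] ev])
      (simp_all add: eqt)
qed

lemma velocity_jac:
  assumes c: "c \<in> A" "\<gamma> t \<in> chdom c" and d: "d \<in> A" "\<gamma> t \<in> chdom d"
  shows "velocity \<gamma> d t = jac c d (\<gamma> t) (velocity \<gamma> c t)"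
proof -
  have "((\<lambda>s. transition c d (chmap c (\<gamma> s))) has_derivative
      (\<lambda>h. jac c d (\<gamma> t) (h *\<^sub>R velocity \<gamma> c t))) (at t)"
    using has_derivative_compose[OF velocity(1)[OF c, unfolded has_vector_derivative_def]
        transition_has_derivative[OF c(1) d(1) c(2) d(2)]] .
  moreover have "\<forall>\<^sub>F s in at t. transition c d (chmap c (\<gamma> s)) = chmap d (\<gamma> s)"
    using eventually_chdom[OF c]
    by (auto simp: eventually_at_filter transition_chmap[OF c(1)] elim: eventually_mono)
  ultimately have "((\<lambda>s. chmap d (\<gamma> s)) has_derivative
      (\<lambda>h. jac c d (\<gamma> t) (h *\<^sub>R velocity \<gamma> c t))) (at t)"
    by (rule has_derivative_transform_eventually) (simp_all add: transition_chmap[OF c])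
  then have "((\<lambda>s. chmap d (\<gamma> s)) has_vector_derivative jac c d (\<gamma> t) (velocity \<gamma> c t)) (at t)"
    by (simp add: has_vector_derivative_def linear_scale[OF linear_jac[OF c(1) d(1) c(2) d(2)]])
  then show ?thesis by (simp add: velocity_def vector_derivative_at)
qed

context
  fixes X :: "('m, 'e) chart \<Rightarrow> 'e \<Rightarrow> 'e"
  assumes X_jac: "\<And>c d p. c \<in> A \<Longrightarrow> d \<in> A \<Longrightarrow> p \<in> chdom c \<Longrightarrow> p \<in> chdom d \<Longrightarrow>
    X d (chmap d p) = jac c d p (X c (chmap c p))"
begin

lemma velocity_pairing_eq:
  assumes c: "c \<in> A" "\<gamma> t \<in> chdom c"
  shows "velocity_pairing \<gamma> X t = g c (chmap c (\<gamma> t)) (velocity \<gamma> c t) (X c (chmap c (\<gamma> t)))"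
proof -
  define d where "d = (SOME c. c \<in> A \<and> \<gamma> t \<in> chdom c)"
  have d: "d \<in> A" "\<gamma> t \<in> chdom d"
    using someI[of "\<lambda>c. c \<in> A \<and> \<gamma> t \<in> chdom c" c] c by (simp_all add: d_def)
  have "velocity_pairing \<gamma> X t = g d (chmap d (\<gamma> t)) (velocity \<gamma> d t) (X d (chmap d (\<gamma> t)))"
    by (simp add: velocity_pairing_def Let_def d_def)
  then show ?thesis
    by (simp add: velocity_jac[OF c d] X_jac[OF c(1) d(1) c(2) d(2)] metric_jac[OF c d])
qed

text \<open>Here \<open>T w\<close> is the covariant derivative of \<open>X\<close> in the direction
  \<open>w\<close>. Metric compatibility and the vanishing acceleration of a geodesic leave only the
  term in which \<open>X\<close> is differentiated.\<close>

lemma velocity_pairing_derivative: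
  assumes c: "c \<in> A" "\<gamma> t \<in> chdom c" and x: "x = chmap c (\<gamma> t)"
    and X: "(X c has_derivative (\<lambda>w. T w - levi_civita g c x w (X c x))) (at x)"
  shows "(velocity_pairing \<gamma> X has_real_derivative g c x (velocity \<gamma> c t) (T (velocity \<gamma> c t))) (at t)"
proof -
  let ?x = "\<lambda>s. chmap c (\<gamma> s)" and ?v = "velocity \<gamma> c"
  let ?\<Gamma> = "levi_civita g c x"
  have xc: "x \<in> chimg c" using c x by (simp add: chmap_in)
  have xd: "(?x has_derivative (\<lambda>h. h *\<^sub>R ?v t)) (at t)"
    using velocity(1)[OF c] by (simp add: has_vector_derivative_def)
  have ev: "\<forall>\<^sub>F s in nhds t. bilinear (g c (?x s))"
    using eventually_chdom[OF c] by eventually_elim (simp add: bilinear_metric c chmap_in)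
  have bil: "bilinear (g c x)" by (rule bilinear_metric[OF c(1) xc])
  have gd: "((\<lambda>s. g c (?x s) u v) has_derivative (\<lambda>h. dder (\<lambda>y. g c y u v) x (h *\<^sub>R ?v t))) (at t)" for u v
    using has_derivative_compose[OF xd, of "\<lambda>y. g c y u v"] metric_has_derivative[OF c(1) xc] x by simp
  have gl: "linear (dder (\<lambda>y. g c y u v) x)" for u v
    using metric_has_derivative[OF c(1) xc] has_derivative_linear by blast
  have Xd: "((\<lambda>s. X c (?x s)) has_derivative
      (\<lambda>h. T (h *\<^sub>R ?v t) - ?\<Gamma> (h *\<^sub>R ?v t) (X c x))) (at t)"
    using has_derivative_compose[OF xd, of "X c"] X x by simp
  have Xl: "T (h *\<^sub>R w) - ?\<Gamma> (h *\<^sub>R w) (X c x) = h *\<^sub>R (T w - ?\<Gamma> w (X c x))" for h w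
    using linear_scale[OF has_derivative_linear[OF X]] .
  have vd: "(?v has_derivative (\<lambda>h. h *\<^sub>R - ?\<Gamma> (?v t) (?v t))) (at t)"
    using velocity(2)[OF c] by (simp add: has_vector_derivative_def x)
  have "((\<lambda>s. g c (?x s) (?v s) (X c (?x s))) has_derivative
    (\<lambda>h. h * (dder (\<lambda>y. g c y (?v t) (X c x)) x (?v t) + g c x (- ?\<Gamma> (?v t) (?v t)) (X c x)
      + g c x (?v t) (T (?v t) - ?\<Gamma> (?v t) (X c x))))) (at t)"
    using has_derivative_bilinear_family[OF ev gd vd Xd]
    by (simp only: x[symmetric] Xl linear_scale[OF gl] bilinear_lmul[OF bil] bilinear_rmul[OF bil]
        real_scaleR_def distrib_left)
  \<comment> \<open>Expanding the derivative of the metric gives two coefficient terms, which cancel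
    those from the acceleration and from the derivative of \<open>X\<close>.\<close>
  moreover have "dder (\<lambda>y. g c y (?v t) (X c x)) x (?v t) + g c x (- ?\<Gamma> (?v t) (?v t)) (X c x)
      + g c x (?v t) (T (?v t) - ?\<Gamma> (?v t) (X c x)) = g c x (?v t) (T (?v t))"
    by (simp add: metric_derivative[OF c(1) xc] bilinear_lneg[OF bil] bilinear_rsub[OF bil])
  ultimately have "((\<lambda>s. g c (?x s) (?v s) (X c (?x s))) has_derivative (\<lambda>h. h * g c x (?v t) (T (?v t)))) (at t)"
    by simp
  moreover have "\<forall>\<^sub>F s in at t. g c (?x s) (?v s) (X c (?x s)) = velocity_pairing \<gamma> X s"
    using eventually_chdom[OF c]
    by (auto simp: eventually_at_filter velocity_pairing_eq[OF c(1)] elim: eventually_mono)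
  ultimately have "(velocity_pairing \<gamma> X has_derivative (\<lambda>h. h * g c x (?v t) (T (?v t)))) (at t)"
    by (rule has_derivative_transform_eventually) (simp_all add: velocity_pairing_eq[OF c])
  then show ?thesis by (simp add: has_field_derivative_def mult_commute_abs)
qed

end

end

end

subsection \<open>Strongly degenerate structures\<close>

text \<open>The dimension first forces \<open>D\<close> to be null. What survives is a linear
  relation between \<open>D\<close> and \<open>j D\<close>, and pairing it with \<open>u\<close> and
  \<open>j u\<close> shows that \<open>D\<close> is orthogonal to everything.\<close>

lemma linear_type_faithful:
  fixes b :: "'e::euclidean_space \<Rightarrow> 'e \<Rightarrow> real"
  assumes b: "bilinear b" and sym: "\<And>u v. b u v = b v u" and nd: "\<And>u. (\<forall>v. b u v = 0) \<Longrightarrow> u = 0"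
    and skew: "\<And>u v. b (j u) v = - b u (j v)" and j2: "\<And>u. j (j u) = \<epsilon> *\<^sub>R u"
    and \<epsilon>: "\<epsilon> \<in> {-1, 1}" and dim: "DIM('e) > 2"
    and D: "\<And>u v. b u v *\<^sub>R D - b D v *\<^sub>R u + (\<epsilon> * b u (j v)) *\<^sub>R j D - (\<epsilon> * b D (j v)) *\<^sub>R j u = 0"
  shows "D = 0"
proof -
  have DjD: "b D (j D) = 0" using skew[of D D] sym[of "j D" D] by simp
  have lin: "linear (\<lambda>u. (b u D, b u (j D)))"
    by (rule linearI) (simp_all add: bilinear_ladd[OF b] bilinear_lmul[OF b])
  \<comment> \<open>Two linear conditions cannot separate the points of a space of dimension above
    2, so some nonzero vector is orthogonal to both \<open>D\<close> and \<open>j D\<close>.\<close>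
  have "\<not> inj (\<lambda>u. (b u D, b u (j D)))"
  proof
    assume "inj (\<lambda>u. (b u D, b u (j D)))"
    then have "dim (range (\<lambda>u. (b u D, b u (j D)))) = dim (UNIV :: 'e set)"
      using dim_image_eq[OF lin] by simp
    moreover have "dim (range (\<lambda>u. (b u D, b u (j D)))) \<le> DIM(real \<times> real)" by (rule dim_subset_UNIV)
    ultimately show False using dim by simp
  qed
  then obtain u where u: "u \<noteq> 0" "b u D = 0" "b u (j D) = 0"
    using linear_injective_0[OF lin] by (auto simp: zero_prod_def)
  \<comment> \<open>For this \<open>u\<close> and \<open>v = D\<close> every term vanishes except
    \<open>b D D *\<^sub>R u\<close>.\<close>
  have null: "b D D = 0"
    using D[of u D] u DjD by simp
  have "b u D = 0" for u
  proof -
    have *: "b u D *\<^sub>R D + (\<epsilon> * b u (j D)) *\<^sub>R j D = 0" using D[of u D] null DjD by simp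
    have pair: "b u D * b D w + \<epsilon> * b u (j D) * b (j D) w = 0" for w
    proof -
      have "b (b u D *\<^sub>R D + (\<epsilon> * b u (j D)) *\<^sub>R j D) w = 0"
        unfolding * using b by (rule bilinear_lzero)
      then show ?thesis by (simp add: bilinear_ladd[OF b] bilinear_lmul[OF b])
    qed
    have 1: "(b u D)\<^sup>2 + \<epsilon> * (b u (j D))\<^sup>2 = 0"
      using pair[of u] by (simp add: sym[of D u] sym[of "j D" u] power2_eq_square)
    have "b D (j u) = - b u (j D)" "b (j D) (j u) = - \<epsilon> * b u D"
      using skew[of D u] skew[of D "j u"] sym by (simp_all add: j2 bilinear_rmul[OF b])
    \<comment> \<open>Relation 1 alone would allow equal squares when
      \<open>\<epsilon> = -1\<close>; the vanishing product excludes that.\<close>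
    then have 2: "b u D * b u (j D) = 0" using pair[of "j u"] \<epsilon> by auto
    show ?thesis using 1 2 by auto
  qed
  then show ?thesis using nd sym by metis
qed

locale strongly_degenerate = pseudo_riemannian_manifold A g
  for A :: "('m::{t2_space,second_countable_topology}, 'e::euclidean_space) chart set"
    and g :: "('m, 'e) chart \<Rightarrow> 'e \<Rightarrow> 'e \<Rightarrow> 'e \<Rightarrow> real" +
  fixes \<epsilon> :: real and J :: "('m, 'e) chart \<Rightarrow> 'e \<Rightarrow> 'e \<Rightarrow> 'e"
    and S :: "('m, 'e) chart \<Rightarrow> 'e \<Rightarrow> 'e \<Rightarrow> 'e \<Rightarrow> 'e"
    and \<xi> \<zeta> :: "('m, 'e) chart \<Rightarrow> 'e \<Rightarrow> 'e"
  assumes eps: "\<epsilon> \<in> {-1, 1}" and kaehler: "eps_kaehler_manifold \<epsilon> A g J" and dim: "DIM('e) > 2"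
    and homogeneous: "homogeneous_eps_kaehler_structure A g J S"
    and linear_type: "linear_type_with \<epsilon> A g J S \<xi> \<zeta>"
    and null: "c \<in> A \<Longrightarrow> x \<in> chimg c \<Longrightarrow> g c x (\<xi> c x) (\<xi> c x) = 0"
    and zeta: "c \<in> A \<Longrightarrow> x \<in> chimg c \<Longrightarrow> \<zeta> c x = 0"
begin

lemma J_skew: "c \<in> A \<Longrightarrow> x \<in> chimg c \<Longrightarrow> g c x (J c x u) v = - g c x u (J c x v)"
  and J_square: "c \<in> A \<Longrightarrow> x \<in> chimg c \<Longrightarrow> J c x (J c x u) = \<epsilon> *\<^sub>R u"
  and tensor_J: "tensor_field_11 A J"
  using kaehler unfolding eps_kaehler_manifold_def by blast+

lemma smooth_J: "c \<in> A \<Longrightarrow> smooth_on (chimg c) (\<lambda>x. J c x u)"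
  and linear_J: "c \<in> A \<Longrightarrow> x \<in> chimg c \<Longrightarrow> linear (J c x)"
  and J_jac: "c \<in> A \<Longrightarrow> d \<in> A \<Longrightarrow> p \<in> chdom c \<Longrightarrow> p \<in> chdom d \<Longrightarrow>
    J d (chmap d p) (jac c d p u) = jac c d p (J c (chmap c p) u)"
  using tensor_J unfolding tensor_field_11_def by blast+

lemma xi_field: "vector_field A \<xi>"
  using linear_type unfolding linear_type_with_def by blast

lemma smooth_xi: "c \<in> A \<Longrightarrow> smooth_on (chimg c) (\<xi> c)"
  and xi_jac: "c \<in> A \<Longrightarrow> d \<in> A \<Longrightarrow> p \<in> chdom c \<Longrightarrow> p \<in> chdom d \<Longrightarrow>
    \<xi> d (chmap d p) = jac c d p (\<xi> c (chmap c p))"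
  using xi_field unfolding vector_field_def by blast+

lemma J_xi_jac:
  assumes "c \<in> A" "d \<in> A" "p \<in> chdom c" "p \<in> chdom d"
  shows "J d (chmap d p) (\<xi> d (chmap d p)) = jac c d p (J c (chmap c p) (\<xi> c (chmap c p)))"
  unfolding xi_jac[OF assms] by (rule J_jac[OF assms])

lemma S_eq:
  assumes "c \<in> A" "x \<in> chimg c"
  shows "S c x u v = g c x u v *\<^sub>R \<xi> c x - g c x (\<xi> c x) v *\<^sub>R u
    + (\<epsilon> * g c x u (J c x v)) *\<^sub>R J c x (\<xi> c x) - (\<epsilon> * g c x (\<xi> c x) (J c x v)) *\<^sub>R J c x u"
  using linear_type assms zeta[OF assms] bilinear_lzero[OF bilinear_metric[OF assms]]
  unfolding linear_type_with_def by simp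

lemma metric_xi_J_xi: "c \<in> A \<Longrightarrow> x \<in> chimg c \<Longrightarrow> g c x (\<xi> c x) (J c x (\<xi> c x)) = 0"
  using J_skew[of c x "\<xi> c x" "\<xi> c x"] metric_sym[of c x "\<xi> c x"] by simp

section \<open>Parallelism of \<open>\<xi>\<close> and \<open>J \<xi>\<close> for the Ambrose-Singer
  connection\<close>

definition ambrose_singer :: "('m, 'e) chart \<Rightarrow> 'e \<Rightarrow> 'e \<Rightarrow> 'e \<Rightarrow> 'e" where
  "ambrose_singer c x u v = levi_civita g c x u v - S c x u v"

text \<open>For \<open>g\<close> and \<open>J\<close> the vanishing covariant derivatives are solved
  for the partial derivatives, so that they can be substituted into the product rule for
  \<open>S\<close>.\<close>

lemma
  assumes "c \<in> A" "x \<in> chimg c"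
  shows ambrose_singer_metric: "dder (\<lambda>y. g c y u v) x w = g c x (ambrose_singer c x w u) v + g c x u (ambrose_singer c x w v)"
    and ambrose_singer_J: "dder (\<lambda>y. J c y u) x w = J c x (ambrose_singer c x w u) - ambrose_singer c x w (J c x u)"
    and ambrose_singer_S: "dder (\<lambda>y. S c y u v) x w + ambrose_singer c x w (S c x u v)
      - S c x (ambrose_singer c x w u) v - S c x u (ambrose_singer c x w v) = 0"
proof -
  have "cov02 (ambrose_singer c) (g c) x w u v = 0" "cov12 (ambrose_singer c) (S c) x w u v = 0" "cov11 (ambrose_singer c) (J c) x w u = 0"
    using homogeneous assms unfolding homogeneous_eps_kaehler_structure_def Let_def ambrose_singer_def[abs_def]
    by blast+
  then show "dder (\<lambda>y. g c y u v) x w = g c x (ambrose_singer c x w u) v + g c x u (ambrose_singer c x w v)"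
    "dder (\<lambda>y. J c y u) x w = J c x (ambrose_singer c x w u) - ambrose_singer c x w (J c x u)"
    "dder (\<lambda>y. S c y u v) x w + ambrose_singer c x w (S c x u v) - S c x (ambrose_singer c x w u) v - S c x u (ambrose_singer c x w v) = 0"
    by (simp_all add: cov02_def cov11_def cov12_def algebra_simps)
qed

lemma linear_ambrose_singer:
  assumes "c \<in> A" "x \<in> chimg c"
  shows "linear (ambrose_singer c x w)"
proof -
  have "bilinear (S c x)"
    using homogeneous assms unfolding homogeneous_eps_kaehler_structure_def tensor_field_12_def by blast
  then show ?thesis
    using bilinear_levi_civita[OF assms] unfolding ambrose_singer_def bilinear_def by (metis linear_compose_sub)
qed

lemma J_has_derivative:
  "c \<in> A \<Longrightarrow> x \<in> chimg c \<Longrightarrow> ((\<lambda>y. J c y u) has_derivative dder (\<lambda>y. J c y u) x) (at x)"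
  by (rule smooth_on_has_derivative[OF smooth_J])

lemma xi_has_derivative:
  "c \<in> A \<Longrightarrow> x \<in> chimg c \<Longrightarrow> (\<xi> c has_derivative dder (\<xi> c) x) (at x)"
  by (rule smooth_on_has_derivative[OF smooth_xi])

lemma J_xi_has_derivative:
  assumes c: "c \<in> A" "x \<in> chimg c"
  shows "((\<lambda>y. J c y (\<xi> c y)) has_derivative
    (\<lambda>w. dder (\<lambda>y. J c y (\<xi> c x)) x w + J c x (dder (\<xi> c) x w))) (at x)"
proof (rule has_derivative_linear_family[OF _ J_has_derivative[OF c] xi_has_derivative[OF c]])
  show "\<forall>\<^sub>F y in nhds x. linear (J c y)"
    using eventually_chimg[OF c] by eventually_elim (rule linear_J[OF c(1)])
qed

text \<open>\<open>S\<close> is built from \<open>g\<close>, \<open>J\<close> and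
  \<open>\<xi>\<close>, the first two of which are parallel. In its covariant derivative all
  connection terms cancel, and what remains is the linear-type expression of the defect
  \<open>D\<close>, to which \<open>linear_type_faithful\<close> applies.\<close>

lemma xi_parallel:
  assumes c: "c \<in> A" "x \<in> chimg c"
  shows "dder (\<xi> c) x w = - ambrose_singer c x w (\<xi> c x)"
proof -
  define D where "D = dder (\<xi> c) x w + ambrose_singer c x w (\<xi> c x)"
  note b = bilinear_metric[OF c] and j = linear_J[OF c] and l = linear_ambrose_singer[OF c]
  have dxi: "dder (\<xi> c) x w = D - ambrose_singer c x w (\<xi> c x)" by (simp add: D_def)
  have "D = 0"
  proof (rule linear_type_faithful[OF b metric_sym[OF c] metric_nondegenerate[OF c]
        J_skew[OF c] J_square[OF c] eps dim])
    fix u v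
    note ev = eventually_bilinear_metric[OF c]
    have lin: "\<forall>\<^sub>F y in nhds x. linear (\<lambda>u. g c y u v)" "\<forall>\<^sub>F y in nhds x. linear (g c y u)"
      using ev by (auto simp: bilinear_def elim: eventually_mono)
    note gd = metric_has_derivative[OF c] and Jd = J_has_derivative[OF c] and xd = xi_has_derivative[OF c]
    note d1 = has_derivative_linear_family[OF lin(1) gd xd]
      and d2 = has_derivative_linear_family[OF lin(2) gd Jd]
      and d3 = J_xi_has_derivative[OF c]
      and d4 = has_derivative_bilinear_family[OF ev gd xd Jd[of v]]
    \<comment> \<open>The product rule applied to the four summands of \<open>S_eq\<close>; that
      formula holds throughout the open chart image, so both sides may be differentiated.\<close>
    note d = has_derivative_diff[OF has_derivative_add[OF has_derivative_diff[OF
          has_derivative_scaleR[OF gd[of u v] xd] has_derivative_scaleR[OF d1 has_derivative_const[of u]]]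
          has_derivative_scaleR[OF has_derivative_mult_right[OF d2[of v], of \<epsilon>] d3]]
          has_derivative_scaleR[OF has_derivative_mult_right[OF d4, of \<epsilon>] Jd[of u]]]
    note d = has_derivative_transform_within_open[OF d open_chimg[OF c(1)] c(2), of "\<lambda>y. S c y u v",
        OF S_eq[OF c(1), symmetric]]
    have dS: "dder (\<lambda>y. S c y u v) x w = g c x u v *\<^sub>R dder (\<xi> c) x w + dder (\<lambda>y. g c y u v) x w *\<^sub>R \<xi> c x
        - (dder (\<lambda>y. g c y (\<xi> c x) v) x w + g c x (dder (\<xi> c) x w) v) *\<^sub>R u
        + ((\<epsilon> * g c x u (J c x v)) *\<^sub>R (dder (\<lambda>y. J c y (\<xi> c x)) x w + J c x (dder (\<xi> c) x w))
          + (\<epsilon> * (dder (\<lambda>y. g c y u (J c x v)) x w + g c x u (dder (\<lambda>y. J c y v) x w))) *\<^sub>R J c x (\<xi> c x))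
        - ((\<epsilon> * g c x (\<xi> c x) (J c x v)) *\<^sub>R dder (\<lambda>y. J c y u) x w
          + (\<epsilon> * (dder (\<lambda>y. g c y (\<xi> c x) (J c x v)) x w + g c x (dder (\<xi> c) x w) (J c x v)
             + g c x (\<xi> c x) (dder (\<lambda>y. J c y v) x w))) *\<^sub>R J c x u)"
      using fun_cong[OF frechet_derivative_at[OF d], of w, symmetric] by simp
    note lin_simps = bilinear_ladd[OF b] bilinear_radd[OF b] bilinear_lsub[OF b] bilinear_rsub[OF b]
      bilinear_lmul[OF b] bilinear_rmul[OF b]
      linear_add[OF j] linear_diff[OF j] linear_scale[OF j] linear_add[OF l] linear_diff[OF l] linear_scale[OF l]
    show "g c x u v *\<^sub>R D - g c x D v *\<^sub>R u + (\<epsilon> * g c x u (J c x v)) *\<^sub>R J c x D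
        - (\<epsilon> * g c x D (J c x v)) *\<^sub>R J c x u = 0"
      using ambrose_singer_S[OF c, of u v w]
      unfolding dS dxi S_eq[OF c] ambrose_singer_metric[OF c] ambrose_singer_J[OF c]
      by (simp add: lin_simps algebra_simps)
  qed
  then show ?thesis by (simp add: dxi)
qed

text \<open>Both \<open>J\<close> and \<open>\<xi>\<close> are parallel for
  \<open>ambrose_singer\<close>, hence so is \<open>J \<xi>\<close>. Written with
  \<open>levi_civita\<close>, this has the form that \<open>velocity_pairing_derivative\<close>
  expects, with \<open>T w = S c x w (J c x (\<xi> c x))\<close>.\<close>

lemma J_xi_parallel:
  assumes c: "c \<in> A" "x \<in> chimg c"
  shows "((\<lambda>y. J c y (\<xi> c y)) has_derivative
    (\<lambda>w. S c x w (J c x (\<xi> c x)) - levi_civita g c x w (J c x (\<xi> c x)))) (at x)"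
proof -
  have "dder (\<lambda>y. J c y (\<xi> c x)) x w + J c x (dder (\<xi> c) x w)
      = S c x w (J c x (\<xi> c x)) - levi_civita g c x w (J c x (\<xi> c x))" for w
    unfolding xi_parallel[OF c] ambrose_singer_J[OF c] by (simp add: linear_neg[OF linear_J[OF c]] linear_diff[OF linear_J[OF c]] ambrose_singer_def)
  then show ?thesis using J_xi_has_derivative[OF c] by simp
qed

section \<open>The Riccati equation along geodesics and incompleteness\<close>

lemma geodesic_riccati:
  assumes geod: "geodesic_on A g UNIV \<gamma>"
  defines "a \<equiv> velocity_pairing \<gamma> \<xi>" and "b \<equiv> velocity_pairing \<gamma> (\<lambda>c x. J c x (\<xi> c x))"
  shows "(a has_real_derivative (a t)\<^sup>2 + \<epsilon> * (b t)\<^sup>2) (at t)"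
    and "(b has_real_derivative 2 * a t * b t) (at t)"
proof -
  obtain c where c: "c \<in> A" "\<gamma> t \<in> chdom c" using chart_at by blast
  define x v where "x = chmap c (\<gamma> t)" and "v = velocity \<gamma> c t"
  have x: "x \<in> chimg c" using c by (simp add: x_def chmap_in)
  have a: "a t = g c x v (\<xi> c x)"
    unfolding a_def x_def v_def by (rule velocity_pairing_eq[OF geod xi_jac c])
  have b: "b t = g c x v (J c x (\<xi> c x))"
    unfolding b_def x_def v_def using velocity_pairing_eq[OF geod J_xi_jac c] by simp
  have bil: "bilinear (g c x)" by (rule bilinear_metric[OF c(1) x])
  note simps = S_eq[OF c(1) x] J_square[OF c(1) x] metric_xi_J_xi[OF c(1) x] null[OF c(1) x]
    bilinear_ladd[OF bil] bilinear_radd[OF bil] bilinear_lsub[OF bil] bilinear_rsub[OF bil]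
    bilinear_lmul[OF bil] bilinear_rmul[OF bil]
  have "(\<xi> c has_derivative (\<lambda>w. S c x w (\<xi> c x) - levi_civita g c x w (\<xi> c x))) (at x)"
    using xi_has_derivative[OF c(1) x] xi_parallel[OF c(1) x] by (simp add: ambrose_singer_def)
  from velocity_pairing_derivative[OF geod xi_jac c x_def this]
  have "(a has_real_derivative g c x v (S c x v (\<xi> c x))) (at t)"
    by (simp add: a_def v_def)
  moreover have "g c x v (S c x v (\<xi> c x)) = (a t)\<^sup>2 + \<epsilon> * (b t)\<^sup>2"
    by (simp add: simps a b power2_eq_square)
  ultimately show "(a has_real_derivative (a t)\<^sup>2 + \<epsilon> * (b t)\<^sup>2) (at t)" by simp
  from velocity_pairing_derivative[OF geod J_xi_jac c x_def J_xi_parallel[OF c(1) x]]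
  have "(b has_real_derivative g c x v (S c x v (J c x (\<xi> c x)))) (at t)"
    by (simp add: b_def v_def)
  \<comment> \<open>One factor \<open>\<epsilon>\<close> belongs to the linear-type formula, the
    other to \<open>J\<close> squared; their product 1 lets the two terms add up to
    \<open>2 a b\<close> for both signs.\<close>
  moreover have "g c x v (S c x v (J c x (\<xi> c x))) = b t * a t + (\<epsilon> * \<epsilon>) * (a t * b t)"
    by (simp add: simps a b)
  moreover have "\<epsilon> * \<epsilon> = 1" using eps by auto
  ultimately show "(b has_real_derivative 2 * a t * b t) (at t)" by (simp add: mult.assoc)
qed

text \<open>Nondegeneracy supplies a velocity with nonzero pairing; when
  \<open>\<epsilon> = -1\<close> a complex rescaling of it removes the second pairing.\<close>

lemma riccati_initial_velocity:
  assumes c: "c \<in> A" "x \<in> chimg c" and xi: "\<xi> c x \<noteq> 0"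
  shows "\<exists>v. g c x v (\<xi> c x) \<noteq> 0 \<and> (\<epsilon> = -1 \<longrightarrow> g c x v (J c x (\<xi> c x)) = 0)"
proof -
  note b = bilinear_metric[OF c]
  obtain v where v: "g c x v (\<xi> c x) \<noteq> 0"
    using metric_nondegenerate[OF c, of "\<xi> c x"] metric_sym[OF c] xi by metis
  show ?thesis
  proof (cases "\<epsilon> = -1")
    case True
    let ?\<alpha> = "g c x v (\<xi> c x)" and ?\<beta> = "g c x v (J c x (\<xi> c x))"
    \<comment> \<open>Replacing \<open>v\<close> by \<open>J v\<close> multiplies
      \<open>\<alpha> + i \<beta>\<close> by \<open>i\<close>. The vector \<open>?u\<close>
      therefore multiplies it by its own conjugate, and the result is real and positive.\<close>
    let ?u = "?\<alpha> *\<^sub>R v - ?\<beta> *\<^sub>R J c x v"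
    have "g c x ?u (\<xi> c x) = ?\<alpha>\<^sup>2 + ?\<beta>\<^sup>2" "g c x ?u (J c x (\<xi> c x)) = 0"
      by (simp_all add: bilinear_lsub[OF b] bilinear_lmul[OF b] bilinear_rmul[OF b] bilinear_rneg[OF b]
          J_skew[OF c] J_square[OF c] True power2_eq_square)
    moreover have "?\<alpha>\<^sup>2 + ?\<beta>\<^sup>2 \<noteq> 0" using v by (simp add: sum_power2_eq_zero_iff)
    ultimately show ?thesis by metis
  qed (use v in auto)
qed

lemma not_geodesically_complete:
  assumes c: "c \<in> A" "x \<in> chimg c" and xi: "\<xi> c x \<noteq> 0"
  shows "\<not> geodesically_complete A g"
proof
  assume complete: "geodesically_complete A g"
  obtain v where v: "g c x v (\<xi> c x) \<noteq> 0" "\<epsilon> = -1 \<longrightarrow> g c x v (J c x (\<xi> c x)) = 0"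
    using riccati_initial_velocity[OF c xi] by blast
  obtain I \<gamma>0 where \<gamma>0: "geodesic_on A g I \<gamma>0" "0 \<in> I" "\<gamma>0 0 = chinv c x"
    "((\<lambda>t. chmap c (\<gamma>0 t)) has_vector_derivative v) (at 0)"
    using local_geodesic[OF c] by blast
  obtain \<gamma> where geod: "geodesic_on A g UNIV \<gamma>" and \<gamma>: "\<And>t. t \<in> I \<Longrightarrow> \<gamma> t = \<gamma>0 t"
    using complete \<gamma>0(1) unfolding geodesically_complete_def by blast
  have "open I" using \<gamma>0(1) by (simp add: geodesic_on_def)
  \<comment> \<open>The extension agrees with the local geodesic on an open set around 0, so it
    inherits the initial velocity.\<close>
  then have "((\<lambda>t. chmap c (\<gamma> t)) has_vector_derivative v) (at 0)"
    using has_vector_derivative_transform_within_open[OF \<gamma>0(4) _ \<gamma>0(2)] \<gamma> by simp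
  then have vel: "velocity \<gamma> c 0 = v" by (simp add: velocity_def vector_derivative_at)
  have \<gamma>c: "\<gamma> 0 \<in> chdom c" "chmap c (\<gamma> 0) = x"
    using \<gamma>[OF \<gamma>0(2)] \<gamma>0(3) chinv_in[OF c] chmap_chinv[OF c] by simp_all
  define a b where "a = velocity_pairing \<gamma> \<xi>" and "b = velocity_pairing \<gamma> (\<lambda>c x. J c x (\<xi> c x))"
  have a0: "a 0 = g c x v (\<xi> c x)"
    unfolding a_def using velocity_pairing_eq[OF geod xi_jac c(1) \<gamma>c(1)] by (simp add: \<gamma>c vel)
  have b0: "b 0 = g c x v (J c x (\<xi> c x))"
    unfolding b_def using velocity_pairing_eq[OF geod J_xi_jac c(1) \<gamma>c(1)] by (simp add: \<gamma>c vel)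
  note a = geodesic_riccati(1)[OF geod, folded a_def b_def]
    and b = geodesic_riccati(2)[OF geod, folded a_def b_def]
  from eps consider "\<epsilon> = -1" | "\<epsilon> = 1" by blast
  then show False
  proof cases
    case 1
    define w where "w t = complex_of_real (a t) + \<i> * complex_of_real (b t)" for t
    have "(w has_vector_derivative (w t)\<^sup>2) (at t)" for t
    proof -
      have "(w has_vector_derivative complex_of_real ((a t)\<^sup>2 + \<epsilon> * (b t)\<^sup>2)
          + \<i> * complex_of_real (2 * a t * b t)) (at t)"
        unfolding w_def[abs_def]
        by (intro has_vector_derivative_add has_vector_derivative_mult_right has_vector_derivative_of_real a b)
      moreover have "complex_of_real ((a t)\<^sup>2 + \<epsilon> * (b t)\<^sup>2) + \<i> * complex_of_real (2 * a t * b t) = (w t)\<^sup>2"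
        by (simp add: w_def 1 power2_eq_square algebra_simps)
      ultimately show ?thesis by simp
    qed
    \<comment> \<open>The choice of \<open>v\<close> gives \<open>b 0 = 0\<close>, so the complex
      solution has the real initial value \<open>a 0\<close>.\<close>
    then have "a 0 = 0"
      by (rule riccati_no_global_solution[of w 0]) (simp add: w_def b0 v(2)[rule_format, OF 1])
    then show False using v a0 by simp
  next
    case 2
    \<comment> \<open>The algebra with \<open>i\<close> squared equal to 1 is not a field, but its
      projections \<open>a + b\<close> and \<open>a - b\<close> are multiplicative, and each solves
      the real Riccati equation. Both must start at zero, and adding them gives
      \<open>a 0 = 0\<close>.\<close>
    have "((\<lambda>t. a t + s * b t) has_vector_derivative (a t + s * b t)\<^sup>2) (at t)" if s: "s\<^sup>2 = 1" for s t
    proof -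
      have "((\<lambda>t. a t + s * b t) has_real_derivative ((a t)\<^sup>2 + \<epsilon> * (b t)\<^sup>2) + s * (2 * a t * b t)) (at t)"
        by (intro DERIV_add DERIV_cmult a b)
      moreover have "(a t)\<^sup>2 + \<epsilon> * (b t)\<^sup>2 + s * (2 * a t * b t) = (a t + s * b t)\<^sup>2"
        by (simp add: 2 power2_sum power_mult_distrib s)
      ultimately show ?thesis by (simp add: has_real_derivative_iff_has_vector_derivative)
    qed
    then have "a 0 + s * b 0 = 0" if "s\<^sup>2 = 1" for s
      using riccati_no_global_solution[of "\<lambda>t. a t + s * b t" 0 "a 0 + s * b 0"] that by simp
    from this[of 1] this[of "-1"] have "a 0 = 0" by simp
    then show False using v a0 by simp
  qed
qed

end

theorem corollary5p4:
  fixes \<epsilon> :: real and n :: nat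
    and A :: "('m::{t2_space,second_countable_topology}, 'e::euclidean_space) chart set"
    and g :: "('m, 'e) chart \<Rightarrow> 'e \<Rightarrow> 'e \<Rightarrow> 'e \<Rightarrow> real"
    and J :: "('m, 'e) chart \<Rightarrow> 'e \<Rightarrow> 'e \<Rightarrow> 'e"
  assumes "\<epsilon> \<in> {-1, 1}"
    and "eps_kaehler_manifold \<epsilon> A g J"
    and "connected (UNIV :: 'm set)"
    and "simply_connected (UNIV :: 'm set)"
    and "\<not> flat A g"
    and "DIM('e) = 2 * n + 4"
    and "\<exists>S. homogeneous_eps_kaehler_structure A g J S \<and>
             strongly_degenerate_linear_type \<epsilon> A g J S"
  shows "\<not> geodesically_complete A g"
proof -
  obtain S \<xi> \<zeta> c x where S: "homogeneous_eps_kaehler_structure A g J S"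
    "linear_type_with \<epsilon> A g J S \<xi> \<zeta>"
    and c: "c \<in> A" "x \<in> chimg c" "\<xi> c x \<noteq> 0"
    and null: "\<forall>c\<in>A. \<forall>x\<in>chimg c. g c x (\<xi> c x) (\<xi> c x) = 0"
    and zeta: "\<forall>c\<in>A. \<forall>x\<in>chimg c. \<zeta> c x = 0"
    using assms(7) unfolding strongly_degenerate_linear_type_def by blast
  interpret strongly_degenerate A g \<epsilon> J S \<xi> \<zeta>
    using assms(1,2,6) S null zeta
    by unfold_locales (auto simp: eps_kaehler_manifold_def)
  show ?thesis by (rule not_geodesically_complete[OF c])
qed

end
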